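(* Let $(y,z)\in\Theta$ and let $x$ be a real number greater than $1$. Then $\xi(y,z;\beta^{-1})$ and $\sum_{m=0}^{\infty}\beta^{-\lfloor x^m\rfloor}$ are algebraically independent for any Pisot or Salem number $\beta$.
   Context: Algebraic independence is over $\mathbb{Q}$. A Pisot number is an algebraic integer greater than $1$ whose conjugates other than itself all have absolute value less than $1$. A Salem number is an algebraic integer greater than $1$ whose conjugates other than itself all have absolute value at most $1$, with at least one conjugate of absolute value exactly $1$. Put $\Theta:=\{(y,z)\in\mathbb{R}^2\mid y>0,\text{ or } y=0\text{ and }z>0\}$. For real $R\geq 3$ and $(y,z)\in\Theta$ put $\varphi(y,z;R):=\exp\left((\log R)^{1+y}(\log\log R)^z\right)$, and set $\xi(y,z;X):=1+\sum_{m=3}^{\infty}X^{\lfloor\varphi(y,z;m)\rfloor}$, where $\lfloor x\rfloor$ is the integral part of $x$. *)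

theory Defs
  imports Complex_Main "HOL-Computational_Algebra.Polynomial"
begin

(* An irreducible p with p(\<alpha>) = 0 is the minimal polynomial of \<alpha> over the rationals
   up to a nonzero constant factor, so these are its complex roots, \<alpha> included. *)
definition conjugates :: "real \<Rightarrow> complex set" where
  "conjugates \<alpha> = {w. \<exists>p :: rat poly. irreducible p \<and>
     poly (map_poly of_rat p) \<alpha> = 0 \<and> poly (map_poly of_rat p) w = 0}"

definition pisot_number :: "real \<Rightarrow> bool" where
  "pisot_number \<beta> \<longleftrightarrow> algebraic_int \<beta> \<and> \<beta> > 1 \<and>
     (\<forall>w \<in> conjugates \<beta> - {complex_of_real \<beta>}. cmod w < 1)"

definition salem_number :: "real \<Rightarrow> bool" where
  "salem_number \<beta> \<longleftrightarrow> algebraic_int \<beta> \<and> \<beta> > 1 \<and>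
     (\<forall>w \<in> conjugates \<beta> - {complex_of_real \<beta>}. cmod w \<le> 1) \<and>
     (\<exists>w \<in> conjugates \<beta> - {complex_of_real \<beta>}. cmod w = 1)"

(* A bivariate polynomial P(X, Y) over the rationals is represented as a polynomial in Y whose
   coefficients are polynomials in X. *)
definition eval2 :: "rat poly poly \<Rightarrow> 'a::field_char_0 \<Rightarrow> 'a \<Rightarrow> 'a" where
  "eval2 P a b = poly (map_poly (\<lambda>q. poly (map_poly of_rat q) a) P) b"

definition algebraically_independent :: "'a::field_char_0 \<Rightarrow> 'a \<Rightarrow> bool" where
  "algebraically_independent a b \<longleftrightarrow> (\<forall>P. P \<noteq> 0 \<longrightarrow> eval2 P a b \<noteq> 0)"

definition Theta :: "(real \<times> real) set" where
  "Theta = {(y, z). y > 0 \<or> (y = 0 \<and> z > 0)}"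

(* Intended for R \<ge> 3, where ln R > 1 and both powr bases are positive. *)
definition phi :: "real \<Rightarrow> real \<Rightarrow> real \<Rightarrow> real" where
  "phi y z R = exp ((ln R) powr (1 + y) * (ln (ln R)) powr z)"

(* The index is shifted by 3, so that the sum runs over all integers m \<ge> 3. *)
definition xi :: "real \<Rightarrow> real \<Rightarrow> real \<Rightarrow> real" where
  "xi y z X = 1 + (\<Sum>m::nat. X powi \<lfloor>phi y z (real (m + 3))\<rfloor>)"

end

(* Let S and T be the power series with exponents floor(phi(y,z;m)) and floor(x^m), each with an
   extra constant term 1, so that xi = S(1/beta) and 1 + sum beta^(-floor(x^m)) = T(1/beta).  A
   polynomial relation between the two values says that an integer power series
   G = sum c_ij S^i T^j vanishes at 1/beta.  Two mechanisms then clash.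

   Heads vanish: if the coefficients of G are zero on a run (p, p + Q] with p polynomial in Q, then
   beta^p times the head sum_{n <= p} G_n beta^(-n) is the value at beta of an integer polynomial
   with coefficients of polynomial size in Q, and it is exponentially small in Q.  Since the other
   conjugates of beta lie in the closed unit disc and the norm is an integer, it is zero.

   Isolated leading terms: let S^k T^l be the leading monomial (first in i, then in j).  Clusters of
   k-fold sums of the numbers floor(phi(m)) outnumber the exponents of S^(k-1) T^J, so some
   exponent of S^k has a long window to its right without exponents of S^(k-1) T^J.  Exponents are
   sparse, hence inside this window some exponent a of S^k T^(l-1) is followed by a window without
   exponents of S^k T^(l-1) either.  As consecutive values floor(x^m) have bounded ratio, some
   a + floor(x^m) lies well inside this second window, where only the leading monomial contributes
   to G.  Zero runs on both sides of it give two vanishing heads, whose difference is a nonempty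
   sum of terms of one sign. *)
theory Submission
  imports Defs "Jordan_Normal_Form.Determinant" "Berlekamp_Zassenhaus.Square_Free_Int_To_Square_Free_GFp" "HOL-Computational_Algebra.Fundamental_Theorem_Algebra" "HOL-Analysis.Elementary_Metric_Spaces" "HOL-Analysis.Infinite_Sum" "HOL-Real_Asymp.Real_Asymp"
begin

hide_const (open) up_ring.coeff up_ring.monom module.smult

text \<open>The norm argument bears heads of length \<open>(Q + 1) ^ e\<close> only for a fixed
  \<open>e\<close>. A run of zeros is therefore useful only if its length is at least a fixed power
  of its position, and this decides how fast \<open>phi\<close> may grow. At scale t the window has
  length phi(t), while the cluster that produces it reaches up to phi(t^c). Since log phi(R) is a
  power of log R times a power of log log R, phi(t^c) is at most phi(t)^E with E independent of t.
  The cluster wins the count by one summand: k + 1 arguments, each from a block of t^b0 integers,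
  against k arguments below t^(c+1). The factor T^J costs at most one more factor t, because T has
  only logarithmically many exponents and log phi(t) is smaller than any power of t.
  \<open>Theta\<close> enters from the opposite side: it makes phi outgrow every power of R, so that
  each fixed monomial in S and T has at most Q exponents in a range polynomial in Q. Every passage
  to a subwindow then costs only a factor \<open>Q + 1\<close>.\<close>

interpretation of_rat_poly_hom: map_poly_idom_hom of_rat ..

section \<open>Integer polynomials at an algebraic integer: conjugates and the norm\<close>

definition poly_length :: "int poly \<Rightarrow> int" where
  "poly_length p = (\<Sum>i\<le>degree p. \<bar>coeff p i\<bar>)"

lemma irreducible_factor_root:
  fixes p :: "rat poly" and \<beta> :: "'a::field_char_0"
  assumes "p \<noteq> 0" "poly (map_poly of_rat p) \<beta> = 0"
  shows "\<exists>g h. irreducible g \<and> p = g * h \<and> poly (map_poly of_rat g) \<beta> = 0"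
  using assms
proof (induction "degree p" arbitrary: p rule: less_induct)
  case less
  have nu: "\<not> is_unit p"
  proof
    assume "is_unit p"
    then obtain c where c: "p = [:c:]" by (elim is_unit_polyE)
    then have "c \<noteq> 0" using less.prems(1) by auto
    with c less.prems show False by simp
  qed
  show ?case
  proof (cases "irreducible p")
    case True
    with less.prems show ?thesis by (intro exI[of _ p] exI[of _ 1]) auto
  next
    case False
    with nu less.prems obtain a b where ab: "p = a * b" "\<not> is_unit a" "\<not> is_unit b"
      unfolding irreducible_def by auto
    have nz: "a \<noteq> 0" "b \<noteq> 0" using ab less.prems by auto
    have dg: "degree a > 0" "degree b > 0" using ab nz by (auto simp: is_unit_iff_degree)
    have "poly (map_poly of_rat a) \<beta> * poly (map_poly of_rat b) \<beta> = 0"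
      using less.prems(2) unfolding ab(1) by (simp add: of_rat_poly_hom.hom_mult)
    then consider "poly (map_poly of_rat a) \<beta> = 0" | "poly (map_poly of_rat b) \<beta> = 0" by auto
    then show ?thesis
    proof cases
      case 1
      from less.hyps[OF _ nz(1) 1] dg nz ab(1) obtain g h where
        "irreducible g" "a = g * h" "poly (map_poly of_rat g) \<beta> = 0"
        by (auto simp: degree_mult_eq)
      then show ?thesis using ab(1) by (intro exI[of _ g] exI[of _ "h * b"]) (auto simp: mult.assoc)
    next
      case 2
      from less.hyps[OF _ nz(2) 2] dg nz ab(1) obtain g h where
        "irreducible g" "b = g * h" "poly (map_poly of_rat g) \<beta> = 0"
        by (auto simp: degree_mult_eq)
      then show ?thesis using ab(1) by (intro exI[of _ g] exI[of _ "h * a"]) (auto simp: ac_simps)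
    qed
  qed
qed

lemma of_rat_of_int_poly:
  "map_poly of_rat (map_poly of_int p) = (map_poly of_int p :: 'a::field_char_0 poly)"
  by (subst map_poly_map_poly) (auto simp: o_def)

text \<open>Gauss's lemma: the integral form \<open>rg\<close> of the rational factor
  \<open>g\<close> divides \<open>F\<close> over the integers, so its leading coefficient is a unit.
  Only the sign remains to be adjusted.\<close>

lemma algebraic_int_minimal_polynomial:
  fixes \<beta> :: "'a::field_char_0"
  assumes "algebraic_int \<beta>"
  shows "\<exists>f :: int poly. lead_coeff f = 1 \<and> irreducible (map_poly rat_of_int f) \<and>
    poly (map_poly of_int f) \<beta> = 0"
proof -
  obtain F :: "int poly" where F: "poly (map_poly of_int F) \<beta> = 0" "lead_coeff F = 1"
    using assms by (auto simp: algebraic_int_altdef_ipoly)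
  have "map_poly rat_of_int F \<noteq> 0" using F(2) by auto
  then obtain g h where g: "irreducible g" "map_poly rat_of_int F = g * h"
    "poly (map_poly of_rat g) \<beta> = 0"
    using irreducible_factor_root[of "map_poly rat_of_int F" \<beta>] F(1)
    by (auto simp: of_rat_of_int_poly)
  obtain r rg where rg: "rat_to_normalized_int_poly g = (r, rg)" by fastforce
  obtain s where s: "F = rg * s"
    using rat_to_int_factor_explicit[OF g(2) rg] by (metis mult_smult_right)
  have gr: "g = smult r (map_poly of_int rg)" "r > 0" using rat_to_normalized_int_poly[OF rg] by auto
  have irr: "irreducible (map_poly rat_of_int rg)" using g(1) unfolding gr(1) by simp
  have "map_poly of_rat g = smult (of_rat r) (map_poly of_int rg :: 'a poly)"
    unfolding gr(1) by (simp add: of_rat_hom.map_poly_hom_smult of_rat_of_int_poly)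
  with g(3) gr(2) have root: "poly (map_poly of_int rg) \<beta> = 0" by simp
  have "lead_coeff rg * lead_coeff s = 1" using F(2) unfolding s by (simp add: lead_coeff_mult)
  then consider "lead_coeff rg = 1" | "lead_coeff rg = -1" by (auto simp: zmult_eq_1_iff)
  then show ?thesis
  proof cases
    case 1
    with irr root show ?thesis by blast
  next
    case 2
    have "irreducible (map_poly rat_of_int (- rg))"
      using irr irreducible_smult[of "-1" "map_poly rat_of_int rg"] by (simp add: of_int_poly_hom.hom_uminus)
    moreover have "poly (map_poly of_int (- rg)) \<beta> = 0" using root by (simp add: of_int_poly_hom.hom_uminus)
    ultimately show ?thesis using 2 by (intro exI[of _ "- rg"]) auto
  qed
qed

text \<open>Otherwise a Bezout identity \<open>a * f + b * p = 1\<close>, evaluated at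
  \<open>r\<close>, would give 0 = 1.\<close>

lemma irreducible_common_root_dvd:
  fixes f p :: "rat poly" and r :: "'a::field_char_0"
  assumes "irreducible f" "poly (map_poly of_rat f) r = 0" "poly (map_poly of_rat p) r = 0"
  shows "f dvd p"
proof (rule ccontr)
  assume "\<not> f dvd p"
  with assms(1) have "coprime f p"
    by (intro prime_elem_imp_coprime irreducible_imp_prime_elem) auto
  then obtain a b where "a * f + b * p = 1" using bezout_coefficients_fst_snd[of f p] by (metis coprime_iff_gcd_eq_1)
  then have "poly (map_poly of_rat (a * f + b * p)) r = 1" by simp
  then show False using assms(2,3) by (simp add: of_rat_poly_hom.hom_add of_rat_poly_hom.hom_mult)
qed

text \<open>Separability in characteristic 0: a double root would be shared with
  \<open>pderiv f\<close>, whose degree is smaller. The full count gives the Vandermonde matrix of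
  the roots the same size as the multiplication matrix.\<close>

lemma irreducible_card_roots:
  fixes f :: "rat poly"
  assumes "irreducible f"
  shows "card {z::complex. poly (map_poly of_rat f) z = 0} = degree f"
proof -
  let ?F = "map_poly of_rat f :: complex poly"
  have f0: "f \<noteq> 0" using assms by auto
  have "\<not> is_unit f" using assms by (auto simp: irreducible_def)
  then have dpos: "degree f > 0" using f0 by (simp add: is_unit_iff_degree)
  have "rsquarefree ?F"
    unfolding rsquarefree_roots
  proof (intro allI notI)
    fix a assume a: "poly ?F a = 0 \<and> poly (pderiv ?F) a = 0"
    have "pderiv ?F = map_poly of_rat (pderiv f)" by (simp add: of_rat_hom.map_poly_pderiv)
    with a have "f dvd pderiv f" using irreducible_common_root_dvd[OF assms, of a "pderiv f"] by auto
    moreover have "pderiv f \<noteq> 0" using dpos by (simp add: pderiv_eq_0_iff)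
    ultimately have "degree f \<le> degree (pderiv f)" by (rule dvd_imp_degree_le)
    with dpos show False by (simp add: degree_pderiv)
  qed
  then have "?F = smult (lead_coeff ?F) (\<Prod>z|poly ?F z = 0. [:-z, 1:])"
    using complex_poly_decompose_rsquarefree[of ?F] by simp
  then have "degree ?F = degree (smult (lead_coeff ?F) (\<Prod>z|poly ?F z = 0. [:-z, 1:]))" by simp
  also have "\<dots> = degree (\<Prod>z|poly ?F z = 0. [:-z, 1:])" using f0 by simp
  also have "\<dots> = (\<Sum>z|poly ?F z = 0. degree [:-z, 1:])" by (rule degree_prod_eq_sum_degree) auto
  finally show ?thesis by simp
qed

text \<open>A kernel vector of the transpose is the coefficient vector of a nonzero polynomial of
  degree below \<open>length rs\<close> that vanishes on all of \<open>rs\<close>.\<close>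

lemma vandermonde_det_nonzero:
  assumes "distinct rs"
  shows "det (mat (length rs) (length rs) (\<lambda>(j, k). (rs ! k) ^ j)) \<noteq> (0 :: 'a :: field)"
proof
  let ?n = "length rs"
  let ?U = "mat ?n ?n (\<lambda>(j, k). (rs ! k) ^ j)"
  assume "det ?U = 0"
  then have "det (transpose_mat ?U) = 0" by (subst det_transpose[of _ ?n]) auto
  then obtain v where v: "v \<in> carrier_vec ?n" "v \<noteq> 0\<^sub>v ?n" "transpose_mat ?U *\<^sub>v v = 0\<^sub>v ?n"
    using det_0_iff_vec_prod_zero_field[of "transpose_mat ?U" ?n] by auto
  define q where "q = (\<Sum>j<?n. monom (v $ j) j)"
  have cq: "coeff q j = (if j < ?n then v $ j else 0)" for j
    unfolding q_def by (simp add: coeff_sum)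
  have "poly q (rs ! k) = 0" if k: "k < ?n" for k
  proof -
    have "0 = (transpose_mat ?U *\<^sub>v v) $ k" using v(3) k by simp
    also have "\<dots> = (\<Sum>j<?n. (rs ! k) ^ j * v $ j)"
      using k v(1) by (simp add: scalar_prod_def lessThan_atLeast0)
    also have "\<dots> = poly q (rs ! k)" unfolding q_def
      by (simp add: poly_sum poly_monom mult.commute)
    finally show ?thesis by simp
  qed
  then have sub: "set rs \<subseteq> {z. poly q z = 0}" by (auto simp: in_set_conv_nth)
  have "q \<noteq> 0"
  proof
    assume "q = 0"
    then have "v = 0\<^sub>v ?n" using v(1) cq by (intro eq_vecI) (auto, metis coeff_0)
    with v(2) show False by simp
  qed
  then have "?n \<le> card {z. poly q z = 0}"
    using card_mono[OF poly_roots_finite sub] assms by (simp add: distinct_card)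
  also have "\<dots> \<le> degree q" using \<open>q \<noteq> 0\<close> by (rule card_poly_roots_bound)
  also have "degree q < ?n"
  proof -
    have "coeff q (degree q) \<noteq> 0" using \<open>q \<noteq> 0\<close> by simp
    then show ?thesis using cq by (auto split: if_splits)
  qed
  finally show False by simp
qed

text \<open>The product is the determinant of multiplication by \<open>p\<close> on \<open>\<int>[X]/(f)\<close> in the basis of powers
  of \<open>X\<close>, an integer matrix which the Vandermonde matrix of the roots diagonalises.\<close>

lemma prod_over_conjugates_is_int:
  fixes f p :: "int poly"
  assumes monic: "lead_coeff f = 1" and irr: "irreducible (map_poly rat_of_int f)"
  shows "(\<Prod>z|poly (map_poly of_int f) z = (0::complex). poly (map_poly of_int p) z) \<in> \<int>"
proof -
  define R where "R = {z::complex. poly (map_poly of_int f) z = 0}"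
  have f0: "f \<noteq> 0" using monic by auto
  have finR: "finite R" unfolding R_def using f0 by (intro poly_roots_finite) auto
  obtain rs where rs: "distinct rs" "set rs = R" using finite_distinct_list[OF finR] by auto
  define n where "n = degree f"
  have "card R = n"
    using irreducible_card_roots[OF irr] unfolding R_def n_def by (simp add: of_rat_of_int_poly)
  then have len: "length rs = n" using rs distinct_card by fastforce
  \<comment> \<open>As \<open>f\<close> is monic, pseudo-division is division with remainder over
    the integers. The coefficients of \<open>r i\<close> form row \<open>i\<close> of the
    multiplication matrix.\<close>
  have "\<exists>q r. monom 1 i * p = f * q + r \<and> (\<forall>j\<ge>n. coeff r j = 0)" for i
  proof -
    obtain q r where qr: "pseudo_divmod (monom 1 i * p) f = (q, r)" by fastforce
    show ?thesis using pseudo_divmod[OF f0 qr] monic unfolding n_def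
      by (intro exI[of _ q] exI[of _ r]) (auto simp: coeff_eq_0)
  qed
  then obtain q r where qr: "\<And>i. monom 1 i * p = f * q i + r i" "\<And>i j. j \<ge> n \<Longrightarrow> coeff (r i) j = 0"
    by metis
  let ?P = "\<lambda>z. poly (map_poly of_int p) z :: complex"
  define Mi where "Mi = mat n n (\<lambda>(i, j). coeff (r i) j)"
  define M where "M = map_mat complex_of_int Mi"
  define U where "U = mat n n (\<lambda>(j, k). (rs ! k) ^ j)"
  define D where "D = mat n n (\<lambda>(i, j). if i = j then ?P (rs ! i) else 0)"
  have M: "M \<in> carrier_mat n n" and U: "U \<in> carrier_mat n n" and D: "D \<in> carrier_mat n n"
    by (auto simp: M_def Mi_def U_def D_def)
  have "M * U = U * D"
  proof (rule eq_matI)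
    fix i k assume "i < dim_row (U * D)" "k < dim_col (U * D)"
    then have i: "i < n" and k: "k < n" using U D by auto
    have root: "poly (map_poly of_int f) (rs ! k) = 0"
      using rs(2) k len unfolding R_def by (metis (mono_tags) mem_Collect_eq nth_mem)
    have "(M * U) $$ (i, k) = (\<Sum>j<n. of_int (coeff (r i) j) * (rs ! k) ^ j)"
      using i k M U by (simp add: M_def Mi_def U_def scalar_prod_def lessThan_atLeast0)
    also have "\<dots> = (\<Sum>j\<le>degree (r i). of_int (coeff (r i) j) * (rs ! k) ^ j)"
      by (rule sum.mono_neutral_cong) (auto intro: le_degree simp: coeff_eq_0 qr(2))
    also have "\<dots> = poly (map_poly of_int (r i)) (rs ! k)"
      by (simp add: poly_altdef)
    also have "\<dots> = poly (map_poly of_int (f * q i + r i)) (rs ! k)"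
      using root by (simp add: of_int_poly_hom.hom_add of_int_poly_hom.hom_mult)
    also have "\<dots> = (rs ! k) ^ i * ?P (rs ! k)"
      unfolding qr(1)[symmetric] by (simp add: of_int_poly_hom.hom_mult poly_monom)
    also have "\<dots> = (U * D) $$ (i, k)"
      using i k by (simp add: U_def D_def scalar_prod_def if_distrib[of "\<lambda>t. _ * t"] cong: if_cong)
    finally show "(M * U) $$ (i, k) = (U * D) $$ (i, k)" .
  qed (use M U D in auto)
  then have "det M * det U = det U * det D"
    using det_mult[OF M U] det_mult[OF U D] by metis
  moreover have "det U \<noteq> 0" unfolding U_def len[symmetric] by (rule vandermonde_det_nonzero[OF rs(1)])
  ultimately have "det D = det M" by simp
  also have "\<dots> = of_int (det Mi)" unfolding M_def by simp
  finally have "det D \<in> \<int>" by simp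
  moreover have "det D = (\<Prod>i<n. ?P (rs ! i))"
    by (subst det_lower_triangular[of n])
       (auto simp: D_def prod_list_diag_prod lessThan_atLeast0 intro!: prod.cong)
  moreover have "\<dots> = (\<Prod>z\<in>R. ?P z)"
    by (rule prod.reindex_bij_betw) (use bij_betw_nth[OF rs(1) refl] rs(2) len in \<open>simp add: lessThan_atLeast0\<close>)
  ultimately show ?thesis unfolding R_def by simp
qed

lemma norm_poly_le_poly_length:
  fixes z :: complex
  assumes "cmod z \<le> 1"
  shows "cmod (poly (map_poly of_int p) z) \<le> of_int (poly_length p)"
proof -
  have "cmod (poly (map_poly of_int p) z) \<le> (\<Sum>i\<le>degree p. cmod (of_int (coeff p i) * z ^ i))"
    by (simp add: poly_altdef norm_sum)
  also have "\<dots> \<le> (\<Sum>i\<le>degree p. \<bar>of_int (coeff p i)\<bar>)"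
    by (intro sum_mono) (use assms in \<open>auto simp: norm_mult norm_power intro!: mult_left_le power_le_one\<close>)
  finally show ?thesis by (simp add: poly_length_def)
qed

text \<open>A Liouville inequality: each of the \<open>d\<close> other conjugates contributes a
  factor of at most \<open>poly_length p\<close> to the norm. As \<open>d\<close> depends on \<beta>
  alone, it stays fixed while \<open>p\<close> varies. Apart from \<open>\<beta> > 1\<close>, the
  arithmetic of \<beta> enters the rest of the proof only through this bound.\<close>

lemma small_conjugates_lower_bound:
  assumes alg: "algebraic_int \<beta>"
    and conj: "\<forall>w \<in> conjugates \<beta> - {complex_of_real \<beta>}. cmod w \<le> 1"
  shows "\<exists>d. \<forall>p::int poly. poly (map_poly of_int p) \<beta> \<noteq> 0 \<longrightarrow>
    1 \<le> \<bar>poly (map_poly of_int p) \<beta>\<bar> * of_int (poly_length p) ^ d"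
proof -
  obtain f :: "int poly" where f: "lead_coeff f = 1" "irreducible (map_poly rat_of_int f)"
    "poly (map_poly of_int f) \<beta> = 0"
    using algebraic_int_minimal_polynomial[OF alg] by blast
  define R where "R = {z::complex. poly (map_poly of_int f) z = 0}"
  have finR: "finite R" unfolding R_def using f(1) by (intro poly_roots_finite) auto
  have pc: "poly (map_poly of_int p) (complex_of_real \<beta>) = of_real (poly (map_poly of_int p) \<beta>)" for p :: "int poly"
    by (simp add: poly_altdef)
  have bR: "complex_of_real \<beta> \<in> R" unfolding R_def using pc[of f] f(3) by simp
  have small: "cmod z \<le> 1" if "z \<in> R - {complex_of_real \<beta>}" for z
  proof -
    have "z \<in> conjugates \<beta>" using that f unfolding conjugates_def R_def
      by (auto intro!: exI[of _ "map_poly rat_of_int f"] simp: of_rat_of_int_poly)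
    with that conj show ?thesis by auto
  qed
  show ?thesis
  proof (intro exI[of _ "card (R - {complex_of_real \<beta>})"] allI impI)
    fix p :: "int poly" assume p: "poly (map_poly of_int p) \<beta> \<noteq> 0"
    let ?P = "\<lambda>z. poly (map_poly of_int p) z :: complex"
    \<comment> \<open>A zero at one conjugate forces \<open>f\<close> to divide \<open>p\<close>
      over the rationals, hence a zero at \<beta> as well.\<close>
    have "?P z \<noteq> 0" if "z \<in> R" for z
    proof
      assume "?P z = 0"
      then have "map_poly rat_of_int f dvd map_poly rat_of_int p"
        using irreducible_common_root_dvd[OF f(2), of z "map_poly rat_of_int p"] that
        unfolding R_def by (simp add: of_rat_of_int_poly)
      then obtain h where "map_poly rat_of_int p = map_poly rat_of_int f * h" by auto
      then have "map_poly of_rat (map_poly rat_of_int p) = map_poly of_rat (map_poly rat_of_int f * h)" by simp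
      then have "map_poly of_int p = map_poly of_int f * (map_poly of_rat h :: real poly)"
        by (simp only: of_rat_of_int_poly of_rat_poly_hom.hom_mult)
      then have "poly (map_poly of_int p) \<beta> = 0" using f(3) by simp
      with p show False by simp
    qed
    then have nz: "(\<Prod>z\<in>R. ?P z) \<noteq> 0" using finR by auto
    obtain N where N: "(\<Prod>z\<in>R. ?P z) = of_int N"
      using prod_over_conjugates_is_int[OF f(1,2), of p] unfolding R_def by (auto elim: Ints_cases)
    have "N \<noteq> 0" using nz N by auto
    then have "1 \<le> cmod (\<Prod>z\<in>R. ?P z)" unfolding N by simp
    also have "(\<Prod>z\<in>R. ?P z) = ?P \<beta> * (\<Prod>z\<in>R - {complex_of_real \<beta>}. ?P z)"
      by (rule prod.remove[OF finR bR])
    also have "cmod \<dots> = \<bar>poly (map_poly of_int p) \<beta>\<bar> * (\<Prod>z\<in>R - {complex_of_real \<beta>}. cmod (?P z))"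
      by (simp add: norm_mult prod_norm pc)
    also have "\<dots> \<le> \<bar>poly (map_poly of_int p) \<beta>\<bar> * (\<Prod>z\<in>R - {complex_of_real \<beta>}. of_int (poly_length p))"
      by (intro mult_left_mono prod_mono) (auto intro: norm_poly_le_poly_length small)
    finally show "1 \<le> \<bar>poly (map_poly of_int p) \<beta>\<bar> * of_int (poly_length p) ^ card (R - {complex_of_real \<beta>})"
      by simp
  qed
qed

section \<open>Integer power series with polynomially bounded coefficients and their values\<close>

text \<open>The class is closed under sums and products and guarantees absolute convergence for
  \<open>\<bar>z\<bar> < 1\<close>, so that \<open>fps_value z\<close> respects the ring operations
  on it.\<close>

definition polynomially_bounded :: "int fps \<Rightarrow> bool" where
  "polynomially_bounded F \<longleftrightarrow> (\<exists>C K. \<forall>n. \<bar>fps_nth F n\<bar> \<le> C * (int n + 1) ^ K)"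

definition fps_value :: "real \<Rightarrow> int fps \<Rightarrow> real" where
  "fps_value z F = (\<Sum>n. of_int (fps_nth F n) * z ^ n)"

text \<open>The generating function sum of X^(v m) over all m, with multiplicities. An infinite
  fibre would get the coefficient 0; the growth conditions imposed on \<open>v\<close> exclude
  this.\<close>

definition count_fps :: "(nat \<Rightarrow> nat) \<Rightarrow> int fps" where
  "count_fps v = Abs_fps (\<lambda>n. int (card (v -` {n})))"

lemma polynomially_boundedE:
  assumes "polynomially_bounded F"
  obtains C K where "C > 0" "\<And>n. \<bar>fps_nth F n\<bar> \<le> C * (int n + 1) ^ K"
proof -
  obtain C K where CK: "\<And>n. \<bar>fps_nth F n\<bar> \<le> C * (int n + 1) ^ K"
    using assms unfolding polynomially_bounded_def by auto
  have "\<bar>fps_nth F n\<bar> \<le> (\<bar>C\<bar> + 1) * (int n + 1) ^ K" for n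
    by (rule order.trans[OF CK]) (intro mult_right_mono, auto)
  then show ?thesis by (intro that[of "\<bar>C\<bar> + 1" K]) auto
qed

lemma polynomially_bounded_of_int [intro]: "polynomially_bounded (of_int c)"
  unfolding polynomially_bounded_def
  by (intro exI[of _ "\<bar>c\<bar>"] exI[of _ 0]) (auto simp: fps_of_int[symmetric])

lemma polynomially_bounded_add [intro]:
  assumes "polynomially_bounded F" "polynomially_bounded G"
  shows "polynomially_bounded (F + G)"
proof -
  obtain C K where F: "C > 0" "\<And>n. \<bar>fps_nth F n\<bar> \<le> C * (int n + 1) ^ K"
    using assms(1) by (rule polynomially_boundedE) auto
  obtain D L where G: "D > 0" "\<And>n. \<bar>fps_nth G n\<bar> \<le> D * (int n + 1) ^ L"
    using assms(2) by (rule polynomially_boundedE) auto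
  have "\<bar>fps_nth (F + G) n\<bar> \<le> (C + D) * (int n + 1) ^ (K + L)" for n
  proof -
    have "\<bar>fps_nth (F + G) n\<bar> \<le> C * (int n + 1) ^ K + D * (int n + 1) ^ L"
      using F(2)[of n] G(2)[of n] by simp
    also have "\<dots> \<le> C * (int n + 1) ^ (K + L) + D * (int n + 1) ^ (K + L)"
      using F(1) G(1) by (intro add_mono mult_left_mono power_increasing) auto
    finally show ?thesis by (simp add: algebra_simps)
  qed
  then show ?thesis unfolding polynomially_bounded_def by blast
qed

lemma polynomially_bounded_mult [intro]:
  assumes "polynomially_bounded F" "polynomially_bounded G"
  shows "polynomially_bounded (F * G)"
proof -
  obtain C K where F: "C > 0" "\<And>n. \<bar>fps_nth F n\<bar> \<le> C * (int n + 1) ^ K"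
    using assms(1) by (rule polynomially_boundedE) auto
  obtain D L where G: "D > 0" "\<And>n. \<bar>fps_nth G n\<bar> \<le> D * (int n + 1) ^ L"
    using assms(2) by (rule polynomially_boundedE) auto
  have "\<bar>fps_nth (F * G) n\<bar> \<le> (C * D) * (int n + 1) ^ (K + L + 1)" for n
  proof -
    have "\<bar>fps_nth (F * G) n\<bar> \<le> (\<Sum>i=0..n. \<bar>fps_nth F i\<bar> * \<bar>fps_nth G (n - i)\<bar>)"
      unfolding fps_mult_nth by (rule order.trans[OF sum_abs]) (simp add: abs_mult)
    also have "\<dots> \<le> (\<Sum>i=0..n. (C * (int n + 1) ^ K) * (D * (int n + 1) ^ L))"
    proof (intro sum_mono mult_mono)
      fix i assume i: "i \<in> {0..n}"
      show "\<bar>fps_nth F i\<bar> \<le> C * (int n + 1) ^ K"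
        using i F(1) by (intro order.trans[OF F(2)] mult_left_mono power_mono) auto
      show "\<bar>fps_nth G (n - i)\<bar> \<le> D * (int n + 1) ^ L"
        using i G(1) by (intro order.trans[OF G(2)] mult_left_mono power_mono) auto
    qed (use F(1) in auto)
    also have "\<dots> = (C * D) * (int n + 1) ^ (K + L + 1)" by (simp add: power_add algebra_simps)
    finally show ?thesis .
  qed
  then show ?thesis unfolding polynomially_bounded_def by blast
qed

lemma polynomially_bounded_power [intro]:
  "polynomially_bounded F \<Longrightarrow> polynomially_bounded (F ^ k)"
proof (induction k)
  case 0
  show ?case using polynomially_bounded_of_int[of 1] by simp
qed auto

lemma polynomially_bounded_sum [intro]:
  "(\<And>i. i \<in> I \<Longrightarrow> polynomially_bounded (F i)) \<Longrightarrow> polynomially_bounded (\<Sum>i\<in>I. F i)"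
proof (induction I rule: infinite_finite_induct)
  case (infinite A)
  then show ?case using polynomially_bounded_of_int[of 0] by simp
next
  case empty
  then show ?case using polynomially_bounded_of_int[of 0] by simp
qed auto

text \<open>Induction by termwise differentiation: the derivative of the series with terms n^K z^n
  has the terms (n+1)^(K+1) z^n.\<close>

lemma summable_Suc_power_geometric:
  fixes z :: real
  assumes "\<bar>z\<bar> < 1"
  shows "summable (\<lambda>n. real (Suc n) ^ K * z ^ n)"
  using assms
proof (induction K arbitrary: z)
  case 0
  then show ?case by (simp add: summable_geometric_iff)
next
  case (Suc K)
  have "summable (\<lambda>n. diffs (\<lambda>n. real n ^ K) n * z ^ n)"
  proof (rule termdiff_converges[of z 1])
    fix x :: real assume x: "norm x < 1"
    show "summable (\<lambda>n. real n ^ K * x ^ n)"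
    proof (rule summable_comparison_test)
      show "\<exists>N. \<forall>n\<ge>N. norm (real n ^ K * x ^ n) \<le> real (Suc n) ^ K * \<bar>x\<bar> ^ n"
        by (auto simp: abs_mult power_abs intro!: mult_right_mono power_mono)
      show "summable (\<lambda>n. real (Suc n) ^ K * \<bar>x\<bar> ^ n)" using Suc.IH[of "\<bar>x\<bar>"] x by simp
    qed
  qed (use Suc.prems in auto)
  then show ?case by (simp add: diffs_def)
qed

lemma summable_fps_value:
  assumes "polynomially_bounded F" "\<bar>z\<bar> < 1"
  shows "summable (\<lambda>n. \<bar>real_of_int (fps_nth F n) * z ^ n\<bar>)"
proof -
  obtain C K where F: "C > 0" "\<And>n. \<bar>fps_nth F n\<bar> \<le> C * (int n + 1) ^ K"
    using assms(1) by (rule polynomially_boundedE) auto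
  have F': "\<bar>real_of_int (fps_nth F n)\<bar> \<le> of_int C * real (Suc n) ^ K" for n
  proof -
    have "real_of_int \<bar>fps_nth F n\<bar> \<le> real_of_int (C * (int n + 1) ^ K)"
      using F(2)[of n] by (rule of_int_le_iff[THEN iffD2])
    then show ?thesis by (simp add: add.commute)
  qed
  show ?thesis
  proof (rule summable_comparison_test)
    show "summable (\<lambda>n. of_int C * (real (Suc n) ^ K * \<bar>z\<bar> ^ n))"
      by (intro summable_mult summable_Suc_power_geometric) (use assms in auto)
    show "\<exists>N. \<forall>n\<ge>N. norm \<bar>real_of_int (fps_nth F n) * z ^ n\<bar> \<le> of_int C * (real (Suc n) ^ K * \<bar>z\<bar> ^ n)"
      using F' by (auto simp: abs_mult power_abs mult.assoc[symmetric] simp del: of_nat_Suc intro!: mult_right_mono)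
  qed
qed

lemma fps_value_add:
  assumes "polynomially_bounded F" "polynomially_bounded G" "\<bar>z\<bar> < 1"
  shows "fps_value z (F + G) = fps_value z F + fps_value z G"
  unfolding fps_value_def fps_add_nth of_int_add distrib_right
  by (rule suminf_add[symmetric]; rule summable_rabs_cancel; rule summable_fps_value; fact)

lemma fps_value_mult:
  assumes "polynomially_bounded F" "polynomially_bounded G" "\<bar>z\<bar> < 1"
  shows "fps_value z (F * G) = fps_value z F * fps_value z G"
proof -
  have "fps_value z F * fps_value z G = (\<Sum>n. \<Sum>i\<le>n. (of_int (fps_nth F i) * z ^ i) * (of_int (fps_nth G (n - i)) * z ^ (n - i)))"
    unfolding fps_value_def
    by (rule Cauchy_product) (use summable_fps_value assms in auto)
  also have "\<dots> = fps_value z (F * G)"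
    unfolding fps_value_def fps_mult_nth of_int_sum sum_distrib_right
    by (intro arg_cong[of _ _ suminf] ext sum.cong)
       (auto simp: power_add[symmetric] mult.assoc mult.left_commute atLeast0AtMost)
  finally show ?thesis ..
qed

lemma fps_value_of_int: "fps_value z (of_int c) = of_int c"
proof -
  have "(\<lambda>n. of_int (fps_nth (of_int c) n) * z ^ n) = (\<lambda>n. if n = 0 then real_of_int c else 0)"
    by (auto simp: fps_of_int[symmetric])
  then show ?thesis unfolding fps_value_def using sums_single[of 0 "\<lambda>_. real_of_int c"]
    by (auto intro: sums_unique[symmetric])
qed

lemma fps_value_power:
  assumes "polynomially_bounded F" "\<bar>z\<bar> < 1"
  shows "fps_value z (F ^ k) = fps_value z F ^ k"
proof (induction k)
  case 0
  show ?case using fps_value_of_int[of z 1] by simp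
next
  case (Suc k)
  then show ?case using assms by (simp add: fps_value_mult polynomially_bounded_power)
qed

lemma fps_value_sum:
  assumes "\<And>i. i \<in> I \<Longrightarrow> polynomially_bounded (F i)" "\<bar>z\<bar> < 1"
  shows "fps_value z (\<Sum>i\<in>I. F i) = (\<Sum>i\<in>I. fps_value z (F i))"
  using assms(1)
proof (induction I rule: infinite_finite_induct)
  case (infinite A)
  then show ?case using fps_value_of_int[of z 0] by simp
next
  case empty
  then show ?case using fps_value_of_int[of z 0] by simp
next
  case (insert x I)
  then show ?case using assms(2) by (simp add: fps_value_add polynomially_bounded_sum)
qed

lemma polynomially_bounded_count_fps:
  assumes "\<And>m. m \<ge> m0 \<Longrightarrow> m \<le> v m"
  shows "polynomially_bounded (count_fps v)"
proof -
  have "\<bar>fps_nth (count_fps v) n\<bar> \<le> (int m0 + 1) * (int n + 1) ^ 1" for n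
  proof -
    have "v -` {n} \<subseteq> {..<m0} \<union> {..n}"
    proof
      fix m assume "m \<in> v -` {n}"
      then show "m \<in> {..<m0} \<union> {..n}" using assms[of m] by (cases "m < m0") auto
    qed
    then have "card (v -` {n}) \<le> card ({..<m0} \<union> {..n})" by (intro card_mono) auto
    also have "\<dots> \<le> m0 + (n + 1)" using card_Un_le[of "{..<m0}" "{..n}"] by simp
    also have "\<dots> \<le> (m0 + 1) * (n + 1)" by simp
    finally have "int (card (v -` {n})) \<le> int ((m0 + 1) * (n + 1))" by (simp only: of_nat_le_iff)
    then show ?thesis by (simp add: count_fps_def algebra_simps)
  qed
  then show ?thesis unfolding polynomially_bounded_def by blast
qed

lemma summable_power_of_superlinear:
  fixes z :: real
  assumes ge: "\<And>m. m \<ge> m0 \<Longrightarrow> m \<le> v m" and z: "0 \<le> z" "z < 1"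
  shows "summable (\<lambda>m. z ^ v m)"
proof (rule summable_comparison_test)
  show "summable (\<lambda>m. z ^ m)" using z by (intro summable_geometric) auto
  show "\<exists>N. \<forall>m\<ge>N. norm (z ^ v m) \<le> z ^ m"
    using z ge by (auto intro!: exI[of _ m0] power_decreasing)
qed

text \<open>The terms are nonnegative, so the sum over the indices may be regrouped along the fibres
  of \<open>v\<close>, which are finite by \<open>ge\<close>.\<close>

lemma fps_value_count_fps:
  assumes ge: "\<And>m. m \<ge> m0 \<Longrightarrow> m \<le> v m" and z: "0 \<le> z" "z < 1"
  shows "fps_value z (count_fps v) = (\<Sum>m. z ^ v m)"
proof -
  have fin: "finite (v -` {n})" for n
  proof (rule finite_subset)
    show "v -` {n} \<subseteq> {..<m0} \<union> {..n}"
    proof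
      fix m assume "m \<in> v -` {n}"
      then show "m \<in> {..<m0} \<union> {..n}" using ge[of m] by (cases "m < m0") auto
    qed
  qed auto
  have "summable (\<lambda>m. z ^ v m)" by (rule summable_power_of_superlinear[OF ge z])
  then have hs: "((\<lambda>m. z ^ v m) has_sum (\<Sum>m. z ^ v m)) UNIV"
    using z by (intro sums_nonneg_imp_has_sum summable_sums) auto
  have bij: "bij_betw (\<lambda>m. (v m, m)) UNIV (Sigma UNIV (\<lambda>n. v -` {n}))"
    by (rule bij_betwI[of _ _ _ snd]) auto
  have "((\<lambda>(n, m). z ^ n) has_sum (\<Sum>m. z ^ v m)) (Sigma UNIV (\<lambda>n. v -` {n}))"
    using has_sum_reindex_bij_betw[OF bij, of "\<lambda>(n, m). z ^ n"] hs by simp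
  then have "((\<lambda>n. of_int (fps_nth (count_fps v) n) * z ^ n) has_sum (\<Sum>m. z ^ v m)) UNIV"
  proof (rule has_sum_SigmaD)
    fix n :: nat
    have "((\<lambda>m. z ^ n) has_sum (\<Sum>m\<in>v -` {n}. z ^ n)) (v -` {n})"
      by (rule has_sum_finite[OF fin])
    then show "((\<lambda>m. case (n, m) of (n, m) \<Rightarrow> z ^ n) has_sum of_int (fps_nth (count_fps v) n) * z ^ n) (v -` {n})"
      by (simp add: count_fps_def)
  qed
  then have "(\<lambda>n. of_int (fps_nth (count_fps v) n) * z ^ n) sums (\<Sum>m. z ^ v m)"
    by (rule has_sum_imp_sums)
  then show ?thesis unfolding fps_value_def by (rule sums_unique[symmetric])
qed

section \<open>Vanishing of heads in front of runs of zero coefficients\<close>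

lemma polynomial_times_power_eventually_small:
  fixes \<beta> D :: real
  assumes "\<beta> > 1" "D \<ge> 0"
  shows "\<forall>\<^sub>F Q in sequentially. D * real (Q + 2) ^ M * (1 / \<beta>) ^ Q < 1"
proof -
  have "(\<lambda>n. real (Suc n) ^ M * (1 / \<beta>) ^ n) \<longlonglongrightarrow> 0"
    by (rule summable_LIMSEQ_zero[OF summable_Suc_power_geometric]) (use assms in auto)
  then have "(\<lambda>n. D * \<beta> * (real (Suc (Suc n)) ^ M * (1 / \<beta>) ^ Suc n)) \<longlonglongrightarrow> D * \<beta> * 0"
    by (intro tendsto_mult_left) (rule LIMSEQ_Suc)
  then have "\<forall>\<^sub>F n in sequentially. D * \<beta> * (real (Suc (Suc n)) ^ M * (1 / \<beta>) ^ Suc n) < 1"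
    by (rule order_tendstoD) auto
  then show ?thesis
    by eventually_elim (use assms in \<open>simp add: field_simps\<close>)
qed

text \<open>As the total is 0, the head is minus a tail that starts only after \<open>p + Q\<close>;
  once multiplied by \<open>\<beta> ^ p\<close>, it is of order \<open>(1 / \<beta>) ^ Q\<close> up
  to polynomial factors. These factors involve \<open>p\<close>, which is why \<open>p\<close> is
  restricted to a fixed power of \<open>Q\<close>.\<close>

lemma head_vanishes:
  fixes \<beta> :: real
  assumes \<beta>: "\<beta> > 1" and pb: "polynomially_bounded F" and zero: "fps_value (1 / \<beta>) F = 0"
    and lower: "\<And>p::int poly. poly (map_poly of_int p) \<beta> \<noteq> 0 \<Longrightarrow>
      1 \<le> \<bar>poly (map_poly of_int p) \<beta>\<bar> * of_int (poly_length p) ^ d"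
  shows "\<forall>\<^sub>F Q in sequentially. \<forall>p\<le>(Q + 1) ^ e.
    (\<forall>n. p < n \<and> n \<le> p + Q \<longrightarrow> fps_nth F n = 0) \<longrightarrow>
    (\<Sum>n\<le>p. of_int (fps_nth F n) * (1 / \<beta>) ^ n) = 0"
proof -
  define z where "z = 1 / \<beta>"
  have z: "0 < z" "z < 1" using \<beta> by (auto simp: z_def)
  obtain C0 K where F0: "C0 > 0" "\<And>n. \<bar>fps_nth F n\<bar> \<le> C0 * (int n + 1) ^ K"
    using pb by (rule polynomially_boundedE) auto
  define C where "C = real_of_int C0"
  have C: "C > 0" using F0(1) by (simp add: C_def)
  have F: "\<bar>real_of_int (fps_nth F n)\<bar> \<le> C * real (n + 1) ^ K" for n
  proof -
    have "real_of_int \<bar>fps_nth F n\<bar> \<le> real_of_int (C0 * (int n + 1) ^ K)"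
      using F0(2)[of n] by (rule of_int_le_iff[THEN iffD2])
    then show ?thesis by (simp add: C_def add.commute)
  qed
  define A where "A = (\<Sum>i. real (Suc i) ^ K * z ^ i)"
  have sA: "summable (\<lambda>i. real (Suc i) ^ K * z ^ i)" by (rule summable_Suc_power_geometric) (use z in auto)
  have A: "A \<ge> 0" unfolding A_def by (intro suminf_nonneg sA) (use z in auto)
  \<comment> \<open>The tail costs \<open>X ^ K\<close> and the \<open>d\<close>-th power of the
    length of \<open>P\<close> costs \<open>X ^ ((K + 1) * d)\<close>, where
    \<open>X = p + Q + 2\<close> is at most \<open>(Q + 2) ^ (e + 2)\<close>.\<close>
  define M where "M = (e + 2) * (K + (K + 1) * d)"
  have "\<forall>\<^sub>F Q in sequentially. (C * A * C ^ d) * real (Q + 2) ^ M * (1 / \<beta>) ^ Q < 1"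
    by (rule polynomial_times_power_eventually_small) (use \<beta> A C in auto)
  then show ?thesis
  proof (rule eventually_mono)
    fix Q
    assume Q: "(C * A * C ^ d) * real (Q + 2) ^ M * (1 / \<beta>) ^ Q < 1"
    show "\<forall>p\<le>(Q + 1) ^ e. (\<forall>n. p < n \<and> n \<le> p + Q \<longrightarrow> fps_nth F n = 0) \<longrightarrow>
      (\<Sum>n\<le>p. of_int (fps_nth F n) * (1 / \<beta>) ^ n) = 0"
    proof (intro allI impI, rule ccontr)
      fix p
      assume p: "p \<le> (Q + 1) ^ e"
      assume gap: "\<forall>n. p < n \<and> n \<le> p + Q \<longrightarrow> fps_nth F n = 0"
      define h where "h = (\<Sum>n\<le>p. of_int (fps_nth F n) * z ^ n)"
      assume "(\<Sum>n\<le>p. of_int (fps_nth F n) * (1 / \<beta>) ^ n) \<noteq> 0"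
      then have h0: "h \<noteq> 0" by (simp add: h_def z_def)
      define X where "X = real (p + Q + 2)"
      let ?f = "\<lambda>n. real_of_int (fps_nth F n) * z ^ n"
      let ?t = "\<Sum>i. ?f (i + (p + Q + 1))"
      have sf: "summable ?f" by (rule summable_rabs_cancel[OF summable_fps_value[OF pb]]) (use z in auto)
      have "0 = fps_value z F" using zero by (simp add: z_def)
      also have "\<dots> = ?t + (\<Sum>n<p + Q + 1. ?f n)"
        unfolding fps_value_def by (rule suminf_split_initial_segment[OF sf])
      also have "(\<Sum>n<p + Q + 1. ?f n) = h"
        unfolding h_def by (rule sum.mono_neutral_right) (use gap in auto)
      finally have "\<bar>h\<bar> = \<bar>?t\<bar>" by simp
      also have "\<dots> \<le> (\<Sum>i. C * X ^ K * z ^ (p + Q) * (real (Suc i) ^ K * z ^ i))"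
      proof (rule norm_suminf_le[where 'a = real, unfolded real_norm_def])
        show "summable (\<lambda>i. C * X ^ K * z ^ (p + Q) * (real (Suc i) ^ K * z ^ i))"
          by (intro summable_mult sA)
        fix i
        have "\<bar>?f (i + (p + Q + 1))\<bar> \<le> C * real (i + (p + Q + 1) + 1) ^ K * z ^ (i + (p + Q + 1))"
          unfolding abs_mult using z F[of "i + (p + Q + 1)"] by (intro mult_mono) auto
        also have "\<dots> \<le> C * (X * real (Suc i)) ^ K * z ^ (i + (p + Q))"
        proof (intro mult_mono power_mono power_decreasing)
          \<comment> \<open>This separates the dependence on \<open>p + Q\<close> from a factor in
            \<open>i\<close> that is summable against \<open>z ^ i\<close>.\<close>
          have "i + (p + Q + 1) + 1 \<le> (p + Q + 2) * Suc i" by simp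
          then show "real (i + (p + Q + 1) + 1) \<le> X * real (Suc i)"
            unfolding X_def by (metis of_nat_le_iff of_nat_mult)
        qed (use C z in \<open>auto simp: X_def\<close>)
        finally show "\<bar>?f (i + (p + Q + 1))\<bar> \<le> C * X ^ K * z ^ (p + Q) * (real (Suc i) ^ K * z ^ i)"
          by (simp add: power_add power_mult_distrib mult_ac)
      qed
      also have "\<dots> = C * X ^ K * z ^ (p + Q) * A"
        unfolding A_def by (rule suminf_mult[OF sA])
      finally have hle: "\<bar>h\<bar> \<le> C * X ^ K * z ^ (p + Q) * A" .
      \<comment> \<open>The head with its coefficients reversed: the factor
        \<open>\<beta> ^ p\<close> clears the negative powers of \<beta>.\<close>
      define P where "P = (\<Sum>n\<le>p. monom (fps_nth F n) (p - n))"
      have "poly (map_poly of_int P) \<beta> = (\<Sum>n\<le>p. of_int (fps_nth F n) * \<beta> ^ (p - n))"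
        unfolding P_def by (simp add: of_int_poly_hom.hom_sum poly_sum poly_monom)
      also have "\<dots> = \<beta> ^ p * h"
        unfolding h_def sum_distrib_left z_def
        by (rule sum.cong) (use \<beta> in \<open>auto simp: power_diff field_simps\<close>)
      finally have Ph: "poly (map_poly of_int P) \<beta> = \<beta> ^ p * h" .
      have cP: "coeff P i = (if i \<le> p then fps_nth F (p - i) else 0)" for i
      proof -
        have "coeff P i = (\<Sum>n\<le>p. if p - n = i then fps_nth F n else 0)"
          unfolding P_def by (simp add: coeff_sum)
        also have "\<dots> = (\<Sum>n\<in>(if i \<le> p then {p - i} else {}). fps_nth F n)"
          by (rule sum.mono_neutral_cong_right) (auto split: if_splits)
        finally show ?thesis by simp
      qed
      have "degree P \<le> p" by (rule degree_le) (simp add: cP)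
      then have "poly_length P \<le> (\<Sum>i\<le>p. \<bar>coeff P i\<bar>)"
        unfolding poly_length_def by (intro sum_mono2) auto
      then have "real_of_int (poly_length P) \<le> real_of_int (\<Sum>i\<le>p. \<bar>coeff P i\<bar>)"
        by (rule of_int_le_iff[THEN iffD2])
      also have "\<dots> = (\<Sum>i\<le>p. \<bar>real_of_int (coeff P i)\<bar>)" by simp
      also have "\<dots> \<le> (\<Sum>i\<le>p. C * X ^ K)"
      proof (rule sum_mono)
        fix i assume "i \<in> {..p}"
        then have "\<bar>real_of_int (coeff P i)\<bar> \<le> C * real (p - i + 1) ^ K" using F[of "p - i"] by (simp add: cP)
        also have "\<dots> \<le> C * X ^ K" using C by (intro mult_left_mono power_mono) (auto simp: X_def)
        finally show "\<bar>real_of_int (coeff P i)\<bar> \<le> C * X ^ K" .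
      qed
      also have "\<dots> = real (p + 1) * (C * X ^ K)" by simp
      also have "\<dots> \<le> X * (C * X ^ K)" using C by (intro mult_right_mono) (auto simp: X_def)
      finally have L: "real_of_int (poly_length P) \<le> C * X ^ (K + 1)" by (simp add: mult_ac)
      have L0: "0 \<le> real_of_int (poly_length P)" by (simp add: poly_length_def sum_nonneg)
      have "1 \<le> \<bar>\<beta> ^ p * h\<bar> * of_int (poly_length P) ^ d"
        using lower[of P] h0 \<beta> unfolding Ph by simp
      also have "\<dots> \<le> (\<beta> ^ p * (C * X ^ K * z ^ (p + Q) * A)) * (C * X ^ (K + 1)) ^ d"
        using hle L L0 \<beta> C A z by (intro mult_mono power_mono) (auto simp: abs_mult X_def)
      also have "\<dots> = (C * A * C ^ d) * X ^ (K + (K + 1) * d) * z ^ Q"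
      proof -
        have "\<beta> ^ p * z ^ (p + Q) = z ^ Q" using \<beta> by (simp add: z_def power_add field_simps)
        then have "(\<beta> ^ p * (C * X ^ K * z ^ (p + Q) * A)) * (C * X ^ (K + 1)) ^ d =
          C * X ^ K * z ^ Q * A * (C * X ^ (K + 1)) ^ d" by (simp add: mult_ac)
        moreover have "(C * X ^ (K + 1)) ^ d = C ^ d * X ^ ((K + 1) * d)"
          by (simp only: power_mult_distrib power_mult)
        ultimately show ?thesis
          unfolding power_add[of X K "(K + 1) * d"] by (simp only: mult_ac)
      qed
      also have "\<dots> \<le> (C * A * C ^ d) * (real (Q + 2) ^ (e + 2)) ^ (K + (K + 1) * d) * z ^ Q"
      proof (intro mult_right_mono mult_left_mono power_mono)
        have "p + Q + 2 \<le> (Q + 2) ^ e + (Q + 2)" using p power_mono[of "Q + 1" "Q + 2" e] by linarith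
        also have "\<dots> \<le> (Q + 2) ^ (e + 1) + (Q + 2) ^ (e + 1)"
          by (intro add_mono power_increasing self_le_power) auto
        also have "\<dots> = 2 * (Q + 2) ^ (e + 1)" by simp
        also have "\<dots> \<le> (Q + 2) * (Q + 2) ^ (e + 1)" by (intro mult_right_mono) auto
        also have "\<dots> = (Q + 2) ^ (e + 2)" by simp
        finally show "X \<le> real (Q + 2) ^ (e + 2)" unfolding X_def by (metis of_nat_le_iff of_nat_power)
      qed (use C A z in \<open>auto simp: X_def\<close>)
      also have "\<dots> = (C * A * C ^ d) * real (Q + 2) ^ M * (1 / \<beta>) ^ Q"
        unfolding M_def power_mult z_def ..
      finally show False using Q by simp
    qed
  qed
qed

section \<open>Supports of products as sumsets, and their counting functions\<close>

definition fps_support :: "'a::zero fps \<Rightarrow> nat set" where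
  "fps_support F = {n. fps_nth F n \<noteq> 0}"

lemma fps_support_mult_subset:
  fixes F G :: "int fps"
  assumes "n \<in> fps_support (F * G)"
  shows "\<exists>i j. n = i + j \<and> i \<in> fps_support F \<and> j \<in> fps_support G"
proof (rule ccontr)
  assume "\<not> ?thesis"
  then have "\<And>i. i \<le> n \<Longrightarrow> fps_nth F i * fps_nth G (n - i) = 0"
    unfolding fps_support_def by (metis (mono_tags, lifting) le_add_diff_inverse mem_Collect_eq mult_eq_0_iff)
  then have "fps_nth (F * G) n = 0" unfolding fps_mult_nth by (intro sum.neutral) auto
  with assms show False by (simp add: fps_support_def)
qed

lemma fps_mult_nonneg:
  fixes F G :: "int fps"
  assumes "\<And>n. fps_nth F n \<ge> 0" "\<And>n. fps_nth G n \<ge> 0"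
  shows "fps_nth (F * G) n \<ge> 0"
  unfolding fps_mult_nth by (intro sum_nonneg mult_nonneg_nonneg assms)

lemma fps_power_nonneg:
  fixes F :: "int fps"
  assumes "\<And>n. fps_nth F n \<ge> 0"
  shows "fps_nth (F ^ k) n \<ge> 0"
proof (induction k arbitrary: n)
  case 0
  then show ?case by simp
next
  case (Suc k)
  then show ?case using fps_mult_nonneg[OF assms, of "F ^ k"] by simp
qed

text \<open>Nonnegative coefficients exclude cancellation, so every sum of exponents survives in the
  product.\<close>

lemma fps_support_multI:
  fixes F G :: "int fps"
  assumes nn: "\<And>n. fps_nth F n \<ge> 0" "\<And>n. fps_nth G n \<ge> 0"
    and "i \<in> fps_support F" "j \<in> fps_support G"
  shows "i + j \<in> fps_support (F * G)"
proof -
  have "0 < fps_nth F i * fps_nth G (i + j - i)"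
    using assms nn(1)[of i] nn(2)[of j] by (simp add: fps_support_def less_le)
  also have "\<dots> \<le> (\<Sum>k=0..i + j. fps_nth F k * fps_nth G (i + j - k))"
    by (rule member_le_sum) (auto intro: mult_nonneg_nonneg nn)
  finally show ?thesis by (simp add: fps_support_def fps_mult_nth)
qed

lemma fps_support_power_mono:
  fixes F :: "int fps"
  assumes nn: "\<And>n. fps_nth F n \<ge> 0" and "0 \<in> fps_support F" "i \<le> j"
  shows "fps_support (F ^ i) \<subseteq> fps_support (F ^ j)"
proof -
  have "fps_support (F ^ i) \<subseteq> fps_support (F ^ (i + d))" for d
  proof (induction d)
    case (Suc d)
    have "n \<in> fps_support (F ^ (i + Suc d))" if "n \<in> fps_support (F ^ (i + d))" for n
      using fps_support_multI[OF nn fps_power_nonneg[OF nn] assms(2) that] by simp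
    with Suc show ?case by blast
  qed simp
  from this[of "j - i"] assms(3) show ?thesis by simp
qed

lemma fps_support_mult_mono:
  fixes F G F' G' :: "int fps"
  assumes "\<And>n. fps_nth F' n \<ge> 0" "\<And>n. fps_nth G' n \<ge> 0"
    and "fps_support F \<subseteq> fps_support F'" "fps_support G \<subseteq> fps_support G'"
  shows "fps_support (F * G) \<subseteq> fps_support (F' * G')"
proof
  fix n assume "n \<in> fps_support (F * G)"
  then obtain i j where "n = i + j" "i \<in> fps_support F" "j \<in> fps_support G"
    using fps_support_mult_subset by blast
  then show "n \<in> fps_support (F' * G')" using fps_support_multI[OF assms(1,2)] assms(3,4) by blast
qed

text \<open>A sum that is at most \<open>N\<close> has both summands at most \<open>N\<close>, so
  the sumset bound holds for the truncated supports.\<close>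

lemma card_fps_support_mult:
  fixes F G :: "int fps"
  shows "card (fps_support (F * G) \<inter> {..N}) \<le> card (fps_support F \<inter> {..N}) * card (fps_support G \<inter> {..N})"
proof -
  let ?A = "fps_support F \<inter> {..N}" and ?B = "fps_support G \<inter> {..N}"
  have "fps_support (F * G) \<inter> {..N} \<subseteq> (\<lambda>(i, j). i + j) ` (?A \<times> ?B)"
  proof
    fix n assume n: "n \<in> fps_support (F * G) \<inter> {..N}"
    then obtain i j where "n = i + j" "i \<in> fps_support F" "j \<in> fps_support G"
      using fps_support_mult_subset by blast
    with n show "n \<in> (\<lambda>(i, j). i + j) ` (?A \<times> ?B)" by (auto intro!: image_eqI[of _ _ "(i, j)"])
  qed
  then have "card (fps_support (F * G) \<inter> {..N}) \<le> card (?A \<times> ?B)"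
    by (rule surj_card_le[rotated]) auto
  then show ?thesis by (simp add: card_cartesian_product)
qed

lemma card_fps_support_power:
  fixes F :: "int fps"
  shows "card (fps_support (F ^ k) \<inter> {..N}) \<le> card (fps_support F \<inter> {..N}) ^ k"
proof (induction k)
  case 0
  have "fps_support (1 :: int fps) \<inter> {..N} = {0}" by (auto simp: fps_support_def)
  then show ?case by simp
next
  case (Suc k)
  have "card (fps_support (F ^ Suc k) \<inter> {..N}) \<le> card (fps_support F \<inter> {..N}) * card (fps_support (F ^ k) \<inter> {..N})"
    using card_fps_support_mult[of F "F ^ k" N] by simp
  also have "\<dots> \<le> card (fps_support F \<inter> {..N}) * card (fps_support F \<inter> {..N}) ^ k"
    by (rule mult_left_mono[OF Suc]) simp
  finally show ?case by simp
qed

section \<open>Sparseness of the exponents of monomials\<close>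

text \<open>Used mostly in inverse form: the number of indices with value at most N is N^o(1), which
  \<open>superpolynomial_sparse\<close> makes precise.\<close>

definition superpolynomial :: "(nat \<Rightarrow> nat) \<Rightarrow> bool" where
  "superpolynomial v \<longleftrightarrow> (\<forall>A. \<exists>m0. \<forall>m\<ge>m0. m ^ A \<le> v m)"

lemma superpolynomial_finite:
  assumes "superpolynomial v"
  shows "finite {m. v m \<le> N}"
proof -
  obtain m0 where m0: "\<And>m. m \<ge> m0 \<Longrightarrow> m ^ 1 \<le> v m"
    using assms unfolding superpolynomial_def by blast
  have "{m. v m \<le> N} \<subseteq> {..m0 + N}"
  proof
    fix m assume "m \<in> {m. v m \<le> N}"
    then show "m \<in> {..m0 + N}" using m0[of m] by (cases "m < m0") auto
  qed
  then show ?thesis by (rule finite_subset) simp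
qed

lemma fps_support_count_fps:
  assumes "superpolynomial v"
  shows "fps_support (count_fps v) = range v"
proof -
  have "finite (v -` {n})" for n
    by (rule finite_subset[OF _ superpolynomial_finite[OF assms, of n]]) auto
  then show ?thesis by (auto simp: fps_support_def count_fps_def)
qed

lemma card_fps_support_count_fps:
  assumes "superpolynomial v"
  shows "card (fps_support (count_fps v) \<inter> {..N}) \<le> card {m. v m \<le> N}"
proof -
  have "range v \<inter> {..N} \<subseteq> v ` {m. v m \<le> N}" by auto
  then show ?thesis unfolding fps_support_count_fps[OF assms]
    by (rule surj_card_le[OF superpolynomial_finite[OF assms]])
qed

text \<open>Among \<open>c\<close> indices with value at most \<open>(Q + 1) ^ e\<close> one is at
  least \<open>c - 1\<close>, so \<open>(c - 1) ^ (2 * s) \<le> (Q + 1) ^ e\<close>. If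
  \<open>c ^ r > Q\<close>, the right side is at most \<open>c ^ (r * e)\<close>, hence at most
  \<open>c ^ s\<close>; taking s-th roots gives \<open>(c - 1) ^ 2 \<le> c\<close>, which is false
  for \<open>c > 3\<close>.\<close>

lemma superpolynomial_sparse:
  assumes "superpolynomial v"
  shows "\<forall>\<^sub>F Q in sequentially. card {m. v m \<le> (Q + 1) ^ e} ^ r \<le> Q"
proof -
  define s where "s = (r + 1) * (e + 1)"
  obtain m0 where m0: "\<And>m. m \<ge> m0 \<Longrightarrow> m ^ (2 * s) \<le> v m"
    using assms unfolding superpolynomial_def by blast
  show ?thesis unfolding eventually_sequentially
  \<comment> \<open>This threshold forces \<open>c > m0 + 3\<close>, so that the index found above
    \<open>c - 1\<close> lies in the range where \<open>m0\<close> applies.\<close>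
  proof (intro exI[of _ "(m0 + 3) ^ r"] allI impI, rule ccontr)
    fix Q assume Q: "(m0 + 3) ^ r \<le> Q"
    define c where "c = card {m. v m \<le> (Q + 1) ^ e}"
    assume "\<not> card {m. v m \<le> (Q + 1) ^ e} ^ r \<le> Q"
    then have cQ: "Q + 1 \<le> c ^ r" by (simp add: c_def)
    with Q have "(m0 + 3) ^ r < c ^ r" by linarith
    then have c: "m0 + 3 < c" using power_less_imp_less_base by blast
    have "\<exists>m\<ge>c - 1. v m \<le> (Q + 1) ^ e"
    proof (rule ccontr)
      assume "\<not> ?thesis"
      then have "{m. v m \<le> (Q + 1) ^ e} \<subseteq> {..<c - 1}" by (auto simp: not_le intro: leI)
      then have "card {m. v m \<le> (Q + 1) ^ e} \<le> card {..<c - 1}" by (intro card_mono) auto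
      then show False using c unfolding c_def[symmetric] by simp
    qed
    then obtain m where m: "m \<ge> c - 1" "v m \<le> (Q + 1) ^ e" by blast
    have "((c - 1) ^ 2) ^ s \<le> m ^ (2 * s)" unfolding power_mult by (intro power_mono m) auto
    also have "\<dots> \<le> v m" using m(1) c by (intro m0) auto
    also have "\<dots> \<le> (Q + 1) ^ e" by (rule m)
    also have "\<dots> \<le> (c ^ r) ^ e" by (rule power_mono[OF cQ]) simp
    also have "\<dots> = c ^ (r * e)" by (simp add: power_mult)
    also have "\<dots> \<le> c ^ s" using c unfolding s_def by (intro power_increasing) auto
    finally have "((c - 1) ^ 2) ^ s \<le> c ^ s" .
    then have "(c - 1) ^ 2 \<le> c" using power_le_imp_le_base[of "(c - 1)\<^sup>2" "s - 1" c] by (simp add: s_def)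
    moreover obtain b where "c = b + 3" "b > 0" using c by (metis add.commute less_diff_conv less_imp_add_positive zero_less_diff add_lessD1 trans_less_add2)
    ultimately show False by (simp add: power2_eq_square algebra_simps)
  qed
qed

text \<open>The exponents \<open>2 * i\<close> and \<open>2 * j\<close> keep each of the two counts
  below the square root of \<open>Q\<close>, hence their product below \<open>Q\<close>.\<close>

lemma sparse_fps_support:
  assumes v: "superpolynomial v" and w: "superpolynomial w"
  shows "\<forall>\<^sub>F Q in sequentially. card (fps_support (count_fps v ^ i * count_fps w ^ j) \<inter> {..(Q + 1) ^ e}) \<le> Q"
  using superpolynomial_sparse[OF v, of e "2 * i"] superpolynomial_sparse[OF w, of e "2 * j"]
proof eventually_elim
  case (elim Q)
  let ?N = "(Q + 1) ^ e"
  let ?a = "card {m. v m \<le> ?N} ^ i" and ?b = "card {m. w m \<le> ?N} ^ j"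
  have "card (fps_support (count_fps v ^ i * count_fps w ^ j) \<inter> {..?N})
    \<le> card (fps_support (count_fps v ^ i) \<inter> {..?N}) * card (fps_support (count_fps w ^ j) \<inter> {..?N})"
    by (rule card_fps_support_mult)
  also have "\<dots> \<le> ?a * ?b"
    by (intro mult_mono order.trans[OF card_fps_support_power] power_mono card_fps_support_count_fps v w) auto
  also have "\<dots> \<le> Q"
  proof (rule power2_le_imp_le)
    have "(?a * ?b)\<^sup>2 = card {m. v m \<le> ?N} ^ (2 * i) * card {m. w m \<le> ?N} ^ (2 * j)"
      by (simp add: power_mult_distrib power_mult[symmetric] mult.commute)
    also have "\<dots> \<le> Q * Q" using elim by (intro mult_mono) auto
    finally show "(?a * ?b)\<^sup>2 \<le> Q\<^sup>2" by (simp add: power2_eq_square)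
  qed simp
  finally show ?case .
qed

section \<open>Free windows and the isolated leading monomial\<close>

text \<open>Pigeonhole: the window has room for \<open>c + 1\<close> disjoint blocks of length
  \<open>g\<close>, but \<open>A\<close> has only \<open>c\<close> points in it.\<close>

lemma free_block:
  fixes A :: "nat set"
  assumes "card (A \<inter> {s<..s + L}) \<le> c" "(c + 1) * g \<le> L"
  shows "\<exists>p\<ge>s. p + g \<le> s + L \<and> A \<inter> {p<..p + g} = {}"
proof (rule ccontr)
  assume contr: "\<not> ?thesis"
  have "\<exists>x. x \<in> A \<inter> {s + i * g<..s + i * g + g}" if "i \<le> c" for i
  proof -
    have "i * g + g \<le> (c + 1) * g" using mult_le_mono1[of "i + 1" "c + 1" g] that by simp
    with assms(2) contr have "A \<inter> {s + i * g<..s + i * g + g} \<noteq> {}"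
      by (metis add.assoc add_le_cancel_left le_add1 order.trans)
    then show ?thesis by blast
  qed
  then obtain f where f: "\<And>i. i \<le> c \<Longrightarrow> f i \<in> A \<inter> {s + i * g<..s + i * g + g}" by metis
  have less: "f i < f j" if "i < j" "j \<le> c" for i j
  proof -
    have "f i \<le> s + i * g + g" using f[of i] that by auto
    also have "\<dots> \<le> s + j * g" using mult_le_mono1[of "i + 1" j g] that by simp
    also have "\<dots> < f j" using f[of j] that by auto
    finally show ?thesis .
  qed
  have inj: "inj_on f {..c}"
  proof (rule inj_onI)
    fix i j assume "i \<in> {..c}" "j \<in> {..c}" "f i = f j"
    then show "i = j" using less[of i j] less[of j i] by (cases i j rule: linorder_cases) auto
  qed
  have "f ` {..c} \<subseteq> A \<inter> {s<..s + L}"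
  proof
    fix x assume "x \<in> f ` {..c}"
    then obtain i where i: "i \<le> c" "x = f i" by auto
    have "i * g + g \<le> (c + 1) * g" using mult_le_mono1[of "i + 1" "c + 1" g] i by simp
    then have "i * g + g \<le> L" using assms(2) by (rule order.trans)
    then show "x \<in> A \<inter> {s<..s + L}" using f[OF i(1)] i by auto
  qed
  then have "card (f ` {..c}) \<le> card (A \<inter> {s<..s + L})" by (intro card_mono) auto
  then show False using assms(1) inj by (simp add: card_image)
qed

text \<open>The free block has to start right after a member of \<open>A\<close>, because values of
  \<open>w\<close> will be added to that member to reach exponents of the next monomial. The last
  member before the block found by pigeonhole serves, since nothing of \<open>A\<close> lies in
  between.\<close>

lemma free_block_after_member:
  fixes A :: "nat set"
  assumes "n0 \<in> A" "card (A \<inter> {n0<..n0 + L}) \<le> c" "(c + 1) * g \<le> L"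
  shows "\<exists>a\<in>A. n0 \<le> a \<and> a + g \<le> n0 + L \<and> A \<inter> {a<..a + g} = {}"
proof -
  obtain p where p: "p \<ge> n0" "p + g \<le> n0 + L" "A \<inter> {p<..p + g} = {}"
    using free_block[OF assms(2,3)] by blast
  define a where "a = Max (A \<inter> {n0..p})"
  have ne: "finite (A \<inter> {n0..p})" "A \<inter> {n0..p} \<noteq> {}" using assms(1) p(1) by auto
  have a: "a \<in> A \<inter> {n0..p}" unfolding a_def by (rule Max_in[OF ne])
  have "A \<inter> {a<..a + g} = {}"
  proof (rule ccontr)
    assume "A \<inter> {a<..a + g} \<noteq> {}"
    then obtain x where x: "x \<in> A" "a < x" "x \<le> a + g" by auto
    show False
    proof (cases "x \<le> p")
      case True
      then have "x \<le> a" unfolding a_def by (intro Max_ge ne) (use x a in auto)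
      with x show False by simp
    next
      case False
      with x a p(3) show False by auto
    qed
  qed
  with a p show ?thesis by (intro bexI[of _ a]) auto
qed

definition boundedly_spaced :: "(nat \<Rightarrow> nat) \<Rightarrow> bool" where
  "boundedly_spaced w \<longleftrightarrow> (\<exists>C N0. \<forall>N\<ge>N0. \<exists>m. N \<le> w m \<and> w m \<le> C * N)"

text \<open>The exponent \<open>e\<close> is fixed before \<open>Q\<close>, as
  \<open>head_vanishes\<close> demands, while \<open>Q\<close> is only required to be arbitrarily
  large. The length \<open>Q ^ 5\<close> pays for two passages to shorter windows, of length
  \<open>Q ^ 3\<close> and then \<open>Q\<close>.\<close>

definition separated :: "(nat \<Rightarrow> nat) \<Rightarrow> (nat \<Rightarrow> nat) \<Rightarrow> bool" where
  "separated v w \<longleftrightarrow> (\<forall>k J. \<exists>e. \<forall>Q0. \<exists>Q\<ge>Q0. \<exists>n0 \<in> fps_support (count_fps v ^ Suc k).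
     n0 \<le> (Q + 1) ^ e \<and> {n0..n0 + Q ^ 5} \<inter> fps_support (count_fps v ^ k * count_fps w ^ J) = {})"

lemma count_fps_nonneg: "fps_nth (count_fps v) n \<ge> 0"
  by (simp add: count_fps_def)

text \<open>Both leading exponents are successors because the argument compares with the monomials
  in which one of them is lowered by 1. The lengths fit as follows:
  \<open>(Q + 1) * Q ^ 3 \<le> Q ^ 5\<close> yields the window free of \<open>A\<close>;
  \<open>N = (Q + 1) * Q\<close> is the length that forces a run of length \<open>Q\<close> free of
  \<open>E\<close>; and \<open>C * N + N \<le> Q ^ 3\<close> leaves room for such a run on either
  side of \<open>n1\<close>.\<close>

lemma no_leading_relation:
  fixes \<beta> :: real and c :: "nat \<Rightarrow> nat \<Rightarrow> int"
  assumes \<beta>: "\<beta> > 1"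
    and lower: "\<And>p::int poly. poly (map_poly of_int p) \<beta> \<noteq> 0 \<Longrightarrow>
      1 \<le> \<bar>poly (map_poly of_int p) \<beta>\<bar> * of_int (poly_length p) ^ d"
    and v: "superpolynomial v" "v 0 = 0" and w: "superpolynomial w" "w 0 = 0"
    and bs: "boundedly_spaced w" and sep: "separated v w"
    and lead: "c (Suc k) (Suc l) \<noteq> 0" "\<And>j. j > Suc l \<Longrightarrow> c (Suc k) j = 0" and J: "Suc l \<le> J"
  shows "fps_value (1 / \<beta>) (\<Sum>i\<le>Suc k. \<Sum>j\<le>J. of_int (c i j) * (count_fps v ^ i * count_fps w ^ j)) \<noteq> 0"
proof
  let ?S = "count_fps v" and ?T = "count_fps w"
  define G where "G = (\<Sum>i\<le>Suc k. \<Sum>j\<le>J. of_int (c i j) * (?S ^ i * ?T ^ j))"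
  assume "fps_value (1 / \<beta>) (\<Sum>i\<le>Suc k. \<Sum>j\<le>J. of_int (c i j) * (?S ^ i * ?T ^ j)) = 0"
  then have zero: "fps_value (1 / \<beta>) G = 0" by (simp add: G_def)
  note nn = count_fps_nonneg fps_power_nonneg fps_mult_nonneg
  have pbS: "polynomially_bounded (count_fps u)" if u: "superpolynomial u" for u
  proof -
    obtain m0 where "\<And>m. m \<ge> m0 \<Longrightarrow> m ^ 1 \<le> u m" using u unfolding superpolynomial_def by blast
    then show ?thesis by (intro polynomially_bounded_count_fps[of m0]) auto
  qed
  have pbG: "polynomially_bounded G" unfolding G_def
    by (intro polynomially_bounded_sum polynomially_bounded_mult polynomially_bounded_of_int
        polynomially_bounded_power pbS v w)
  have supS: "fps_support ?S = range v" "fps_support ?T = range w"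
    using fps_support_count_fps v w by auto
  have zS: "0 \<in> fps_support ?S" "0 \<in> fps_support ?T" unfolding supS using v(2) w(2) by (metis rangeI)+
  define A where "A = fps_support (?S ^ Suc k * ?T ^ l)"
  define B where "B = fps_support (?S ^ k * ?T ^ J)"
  define E where "E = fps_support (?S ^ Suc k * ?T ^ Suc l)"
  \<comment> \<open>Off \<open>A\<close> and \<open>B\<close> only the leading monomial contributes, since \<open>0\<close> is an exponent of \<open>S\<close> and
    \<open>T\<close> and the supports therefore increase with the powers.\<close>
  have term0: "c i j * fps_nth (?S ^ i * ?T ^ j) n = 0"
    if "n \<notin> A" "n \<notin> B" "i \<le> Suc k" "j \<le> J" "(i, j) \<noteq> (Suc k, Suc l)" for i j n
  proof -
    have "i \<le> k \<or> (i = Suc k \<and> j \<le> l) \<or> (i = Suc k \<and> j > Suc l)"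
      using that(3,5) by (simp only: prod.inject) arith
    then consider "i \<le> k" | "i = Suc k" "j \<le> l" | "i = Suc k" "j > Suc l" by blast
    then show ?thesis
    proof cases
      case 1
      then have "fps_support (?S ^ i * ?T ^ j) \<subseteq> B" unfolding B_def
        by (intro fps_support_mult_mono fps_support_power_mono nn zS that)
      with that(2) have "n \<notin> fps_support (?S ^ i * ?T ^ j)" by blast
      then show ?thesis by (simp add: fps_support_def)
    next
      case 2
      then have "fps_support (?S ^ i * ?T ^ j) \<subseteq> A" unfolding A_def
        by (intro fps_support_mult_mono fps_support_power_mono nn zS) auto
      with that(1) have "n \<notin> fps_support (?S ^ i * ?T ^ j)" by blast
      then show ?thesis by (simp add: fps_support_def)
    next
      case 3
      then show ?thesis using lead(2) by simp
    qed
  qed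
  have Gn: "fps_nth G n = c (Suc k) (Suc l) * fps_nth (?S ^ Suc k * ?T ^ Suc l) n"
    if n: "n \<notin> A" "n \<notin> B" for n
  proof -
    have cf: "fps_nth (of_int x * F) n = x * fps_nth F n" for x and F :: "int fps"
      by (metis fps_mult_left_const_nth fps_of_int of_int_eq_id id_apply)
    have "fps_nth G n = (\<Sum>i\<le>Suc k. \<Sum>j\<le>J. c i j * fps_nth (?S ^ i * ?T ^ j) n)"
      unfolding G_def fps_sum_nth cf ..
    also have "\<dots> = (\<Sum>j\<le>J. c (Suc k) j * fps_nth (?S ^ Suc k * ?T ^ j) n)"
      by (subst sum.remove[of _ "Suc k"]) (use term0[OF n] in \<open>auto intro!: sum.neutral\<close>)
    also have "\<dots> = c (Suc k) (Suc l) * fps_nth (?S ^ Suc k * ?T ^ Suc l) n"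
    proof -
      have "(\<Sum>j\<in>{..J} - {Suc l}. c (Suc k) j * fps_nth (?S ^ Suc k * ?T ^ j) n) = 0"
      proof (rule sum.neutral, rule ballI)
        fix j assume "j \<in> {..J} - {Suc l}"
        then show "c (Suc k) j * fps_nth (?S ^ Suc k * ?T ^ j) n = 0" using term0[OF n, of "Suc k" j] by auto
      qed
      then show ?thesis using J by (subst sum.remove[of _ "Suc l"]) auto
    qed
    finally show ?thesis .
  qed
  obtain e where e: "\<And>Q0. \<exists>Q\<ge>Q0. \<exists>n0 \<in> fps_support (?S ^ Suc k). n0 \<le> (Q + 1) ^ e \<and> {n0..n0 + Q ^ 5} \<inter> B = {}"
    using sep unfolding separated_def B_def by metis
  obtain C N0 where CN: "\<And>N. N \<ge> N0 \<Longrightarrow> \<exists>m. N \<le> w m \<and> w m \<le> C * N"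
    using bs unfolding boundedly_spaced_def by blast
  \<comment> \<open>What holds for all large \<open>Q\<close> is collected first, since
    \<open>separated\<close> then supplies only some large \<open>Q\<close>. The exponent
    \<open>e + 6\<close> covers everything up to \<open>n0 + Q ^ 5\<close>.\<close>
  have "\<forall>\<^sub>F Q in sequentially. card (A \<inter> {..(Q + 1) ^ (e + 6)}) \<le> Q \<and> card (E \<inter> {..(Q + 1) ^ (e + 6)}) \<le> Q \<and>
     (\<forall>p\<le>(Q + 1) ^ (e + 6). (\<forall>n. p < n \<and> n \<le> p + Q \<longrightarrow> fps_nth G n = 0) \<longrightarrow>
        (\<Sum>n\<le>p. of_int (fps_nth G n) * (1 / \<beta>) ^ n) = 0)"
    unfolding A_def E_def
    by (intro eventually_conj sparse_fps_support head_vanishes[OF \<beta> pbG zero lower] v w)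
  then obtain Q1 where Q1: "\<And>Q. Q \<ge> Q1 \<Longrightarrow> card (A \<inter> {..(Q + 1) ^ (e + 6)}) \<le> Q"
    "\<And>Q. Q \<ge> Q1 \<Longrightarrow> card (E \<inter> {..(Q + 1) ^ (e + 6)}) \<le> Q"
    "\<And>Q p. Q \<ge> Q1 \<Longrightarrow> p \<le> (Q + 1) ^ (e + 6) \<Longrightarrow> (\<And>n. p < n \<Longrightarrow> n \<le> p + Q \<Longrightarrow> fps_nth G n = 0) \<Longrightarrow>
        (\<Sum>n\<le>p. of_int (fps_nth G n) * (1 / \<beta>) ^ n) = 0"
    unfolding eventually_sequentially by blast
  \<comment> \<open>The summand \<open>2 * (C + 1)\<close> ensures
    \<open>(C + 1) * (Q + 1) \<le> Q * Q\<close>, which is what makes \<open>C * N + N\<close> fit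
    into \<open>Q ^ 3\<close>.\<close>
  obtain Q n0 where Q: "Q \<ge> Q1 + N0 + 2 * (C + 1)" and n0: "n0 \<in> fps_support (?S ^ Suc k)" "n0 \<le> (Q + 1) ^ e"
    "{n0..n0 + Q ^ 5} \<inter> B = {}"
    using e[of "Q1 + N0 + 2 * (C + 1)"] by metis
  have Q2: "Q \<ge> 2" "Q \<ge> Q1" "Q \<ge> N0" using Q by auto
  define N where "N = (Q + 1) * Q"
  have bound: "n0 + Q ^ 5 \<le> (Q + 1) ^ (e + 6)"
  proof -
    have "n0 + Q ^ 5 \<le> (Q + 1) ^ e + (Q + 1) ^ 5" by (intro add_mono n0(2) power_mono) auto
    also have "\<dots> \<le> (Q + 1) ^ (e + 5) + (Q + 1) ^ (e + 5)" by (intro add_mono power_increasing) auto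
    also have "\<dots> = 2 * (Q + 1) ^ (e + 5)" by simp
    also have "\<dots> \<le> (Q + 1) * (Q + 1) ^ (e + 5)" using Q2 by (intro mult_right_mono) auto
    also have "\<dots> = (Q + 1) ^ (e + 6)" by (simp add: numeral_eq_Suc)
    finally show ?thesis .
  qed
  have cardle: "card (X \<inter> {s<..s + L}) \<le> Q" if "s + L \<le> n0 + Q ^ 5" "card (X \<inter> {..(Q + 1) ^ (e + 6)}) \<le> Q" for X s L
  proof -
    have "card (X \<inter> {s<..s + L}) \<le> card (X \<inter> {..(Q + 1) ^ (e + 6)})"
      using that(1) bound by (intro card_mono) auto
    with that(2) show ?thesis by simp
  qed
  have "n0 \<in> A"
  proof -
    have "fps_support (?S ^ Suc k) \<subseteq> A"
    proof
      fix n assume n: "n \<in> fps_support (?S ^ Suc k)"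
      have "0 \<in> fps_support (?T ^ l)"
        by (rule subsetD[OF fps_support_power_mono[OF count_fps_nonneg zS(2), of 0 l]]) (auto simp: fps_support_def)
      from fps_support_multI[OF fps_power_nonneg[OF count_fps_nonneg] fps_power_nonneg[OF count_fps_nonneg] n this]
      show "n \<in> A" by (simp add: A_def)
    qed
    with n0(1) show ?thesis by blast
  qed
  have Qsq: "(C + 1) * (Q + 1) \<le> Q * Q" "Q + 1 \<le> Q * Q"
  proof -
    have "(C + 1) * (Q + 1) \<le> (C + 1) * (2 * Q)" using Q2 by (intro mult_left_mono) auto
    also have "\<dots> = 2 * (C + 1) * Q" by simp
    also have "\<dots> \<le> Q * Q" using Q by (intro mult_right_mono) auto
    finally show "(C + 1) * (Q + 1) \<le> Q * Q" .
    then show "Q + 1 \<le> Q * Q" by simp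
  qed
  have "(Q + 1) * Q ^ 3 \<le> Q * Q * Q ^ 3" using Qsq(2) by (rule mult_right_mono) simp
  then have "(Q + 1) * Q ^ 3 \<le> Q ^ 5" by (simp add: numeral_eq_Suc)
  then obtain a where a: "a \<in> A" "n0 \<le> a" "a + Q ^ 3 \<le> n0 + Q ^ 5" "A \<inter> {a<..a + Q ^ 3} = {}"
    using free_block_after_member[OF \<open>n0 \<in> A\<close> cardle[OF order.refl Q1(1)[OF Q2(2)]]] by blast
  have "N \<ge> N0" using Q2 unfolding N_def by simp
  then obtain m where m: "N \<le> w m" "w m \<le> C * N" using CN by blast
  define n1 where "n1 = a + w m"
  have "(C + 1) * (Q + 1) * Q \<le> Q * Q * Q" using Qsq(1) by (rule mult_right_mono) simp
  then have CNQ: "C * N + N \<le> Q ^ 3" by (simp add: N_def algebra_simps power3_eq_cube)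
  have n1: "a + N \<le> n1" "n1 + N \<le> a + Q ^ 3" using m CNQ by (auto simp: n1_def)
  have n1E: "n1 \<in> E"
  proof -
    have "a + w m \<in> fps_support ((?S ^ Suc k * ?T ^ l) * ?T)"
      by (rule fps_support_multI[OF fps_mult_nonneg[OF fps_power_nonneg[OF count_fps_nonneg]
            fps_power_nonneg[OF count_fps_nonneg]] count_fps_nonneg])
         (use a(1) supS in \<open>auto simp: A_def\<close>)
    then show ?thesis unfolding n1_def E_def by (simp add: mult_ac)
  qed
  have win: "n \<notin> A" "n \<notin> B" if "a < n" "n \<le> a + Q ^ 3" for n
  proof -
    have "n \<in> {n0..n0 + Q ^ 5}" using that a(2,3) by auto
    then show "n \<notin> B" using n0(3) by blast
    show "n \<notin> A" using a(4) that by auto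
  qed
  have Npos: "N \<ge> 1" "(Q + 1) * Q \<le> N" using Q2 by (auto simp: N_def)
  \<comment> \<open>As \<open>p + Q \<le> a + N \<le> n1 \<le> q\<close>, the two runs lie on either
    side of \<open>n1\<close>. Runs free of \<open>E\<close> are enough, because inside the window
    \<open>G\<close> is a multiple of the leading monomial.\<close>
  obtain p where p: "p \<ge> a" "p + Q \<le> a + N" "E \<inter> {p<..p + Q} = {}"
    using free_block[of E a N Q Q, OF cardle[OF _ Q1(2)[OF Q2(2)]] Npos(2)] n1 a(3) by auto
  obtain q where q: "q \<ge> n1" "q + Q \<le> n1 + N" "E \<inter> {q<..q + Q} = {}"
    using free_block[of E n1 N Q Q, OF cardle[OF _ Q1(2)[OF Q2(2)]] Npos(2)] n1 a(3) by auto
  have head0: "(\<Sum>n\<le>x. of_int (fps_nth G n) * (1 / \<beta>) ^ n) = 0"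
    if x: "x \<ge> a" "x + Q \<le> a + Q ^ 3" "E \<inter> {x<..x + Q} = {}" for x
  proof (rule Q1(3)[OF Q2(2)])
    show "x \<le> (Q + 1) ^ (e + 6)" using x a bound by linarith
    fix n assume n: "x < n" "n \<le> x + Q"
    then have "n \<notin> E" using x(3) by auto
    then show "fps_nth G n = 0" using Gn[OF win] n x by (simp add: E_def fps_support_def)
  qed
  have pq: "p < q" "p < n1" using p q n1 Q2 by auto
  have "(\<Sum>n\<in>{p<..q}. of_int (fps_nth G n) * (1 / \<beta>) ^ n) =
    (\<Sum>n\<le>q. of_int (fps_nth G n) * (1 / \<beta>) ^ n) - (\<Sum>n\<le>p. of_int (fps_nth G n) * (1 / \<beta>) ^ n)"
  proof -
    have "{..q} - {..p} = {p<..q}" by auto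
    then show ?thesis using sum_diff[of "{..q}" "{..p}" "\<lambda>n. real_of_int (fps_nth G n) * (1 / \<beta>) ^ n"] pq by simp
  qed
  also have "\<dots> = 0" using head0[of p] head0[of q] p q n1 by simp
  finally have "0 = (\<Sum>n\<in>{p<..q}. real_of_int (fps_nth G n) * (1 / \<beta>) ^ n)" by simp
  also have "\<dots> = (\<Sum>n\<in>{p<..q}. of_int (c (Suc k) (Suc l)) * (of_int (fps_nth (?S ^ Suc k * ?T ^ Suc l) n) * (1 / \<beta>) ^ n))"
  proof (rule sum.cong)
    fix n assume "n \<in> {p<..q}"
    then have "a < n" "n \<le> a + Q ^ 3" using p q n1 by auto
    then show "real_of_int (fps_nth G n) * (1 / \<beta>) ^ n =
      of_int (c (Suc k) (Suc l)) * (of_int (fps_nth (?S ^ Suc k * ?T ^ Suc l) n) * (1 / \<beta>) ^ n)"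
      using Gn[OF win] by simp
  qed simp
  also have "\<dots> = of_int (c (Suc k) (Suc l)) * (\<Sum>n\<in>{p<..q}. of_int (fps_nth (?S ^ Suc k * ?T ^ Suc l) n) * (1 / \<beta>) ^ n)"
    by (simp add: sum_distrib_left)
  finally have "(\<Sum>n\<in>{p<..q}. real_of_int (fps_nth (?S ^ Suc k * ?T ^ Suc l) n) * (1 / \<beta>) ^ n) = 0"
    using lead(1) by simp
  moreover have Tnn: "0 \<le> fps_nth (?S ^ Suc k * ?T ^ Suc l) n" for n
    by (rule fps_mult_nonneg[OF fps_power_nonneg[OF count_fps_nonneg] fps_power_nonneg[OF count_fps_nonneg]])
  ultimately have "real_of_int (fps_nth (?S ^ Suc k * ?T ^ Suc l) n1) * (1 / \<beta>) ^ n1 = 0"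
    by (subst (asm) sum_nonneg_eq_0_iff) (use \<beta> pq q in auto)
  then show False using n1E \<beta> by (simp add: E_def fps_support_def)
qed

section \<open>Growth of \<open>phi\<close>\<close>

lemma ln_phi: "ln (phi y z R) = ln R powr (1 + y) * ln (ln R) powr z"
  by (simp add: phi_def)

lemma phi_ge_1: "phi y z R \<ge> 1"
  by (simp add: phi_def)

text \<open>With \<open>u = ln R\<close> the function is \<open>ln (phi y z R)\<close>. Its
  derivative \<open>?g'\<close> tends to infinity, so its slope eventually exceeds any
  \<open>A\<close>.\<close>

lemma log_phi_increment:
  fixes A :: real
  assumes "(y, z) \<in> Theta"
  shows "\<exists>u0>1. \<forall>u u'. u0 \<le> u \<longrightarrow> u \<le> u' \<longrightarrow>
    u powr (1 + y) * ln u powr z + A * (u' - u) \<le> u' powr (1 + y) * ln u' powr z"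
proof -
  let ?g = "\<lambda>u. u powr (1 + y) * ln u powr z"
  let ?g' = "\<lambda>u. u powr y * ln u powr z * (1 + y + z / ln u)"
  \<comment> \<open>For \<open>y > 0\<close> the power of \<open>u\<close> dominates whatever the
    sign of \<open>z\<close>; for \<open>y = 0\<close> the condition \<open>z > 0\<close> makes the
    power of \<open>ln u\<close> diverge.\<close>
  have "filterlim ?g' at_top at_top"
  proof (cases "y > 0")
    case True
    then show ?thesis by real_asymp
  next
    case False
    with assms have yz: "y = 0" "z > 0" by (auto simp: Theta_def)
    show ?thesis unfolding yz(1) using yz(2) by real_asymp
  qed
  then have "\<forall>\<^sub>F u in at_top. ?g' u \<ge> A" by (simp add: filterlim_at_top)
  then have "\<forall>\<^sub>F u in at_top. u > 1 \<and> ?g' u \<ge> A" using eventually_gt_at_top[of 1] by eventually_elim auto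
  then obtain u0 where u0: "\<And>u. u \<ge> u0 \<Longrightarrow> u > 1 \<and> ?g' u \<ge> A"
    unfolding eventually_at_top_linorder by blast
  show ?thesis
  proof (intro exI[of _ u0] conjI allI impI)
    show "u0 > 1" using u0 by blast
    fix u u' assume u: "u0 \<le> u" "u \<le> u'"
    show "?g u + A * (u' - u) \<le> ?g u'"
    proof -
      have "?g u - A * u \<le> ?g u' - A * u'"
      proof (rule DERIV_nonneg_imp_nondecreasing[OF u(2)])
        fix x assume x: "u \<le> x" "x \<le> u'"
        then have x1: "x > 1" "?g' x \<ge> A" using u0[of x] u by auto
        have e: "x powr (1 + y) = x * x powr y" using x1 by (simp add: powr_add)
        have e': "ln x powr z = ln x * ln x powr (z - 1)" using x1 by (simp add: powr_diff)
        have d1: "((\<lambda>u. u powr (1 + y)) has_real_derivative (1 + y) * x powr y) (at x)"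
          using has_real_derivative_powr[of x "1 + y"] x1 by simp
        have d2: "((\<lambda>u. ln u powr z) has_real_derivative z * ln x powr (z - 1) * (1 / x)) (at x)"
          by (rule DERIV_chain2[OF has_real_derivative_powr DERIV_ln_divide]) (use x1 in auto)
        have cancel: "x * p * (z * q * (1 / x)) = p * (q * l) * (z / l)" if "x \<noteq> 0" "l \<noteq> 0" for p q l :: real
          using that by simp
        have "((\<lambda>u. A * u) has_real_derivative A) (at x)"
          using DERIV_cmult[OF DERIV_ident, of A x] by simp
        from DERIV_diff[OF DERIV_mult[OF d1 d2] this]
        have "((\<lambda>u. ?g u - A * u) has_real_derivative ?g' x - A) (at x)"
        proof (rule DERIV_cong)
          have "x powr (1 + y) * (z * ln x powr (z - 1) * (1 / x)) = x powr y * (ln x powr (z - 1) * ln x) * (z / ln x)"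
            unfolding e by (rule cancel) (use x1 in auto)
          also have "\<dots> = x powr y * ln x powr z * (z / ln x)" unfolding e' by (simp add: mult_ac)
          finally show "(1 + y) * x powr y * ln x powr z + z * ln x powr (z - 1) * (1 / x) * x powr (1 + y) - A = ?g' x - A"
            by (simp add: algebra_simps)
        qed
        then show "\<exists>d. ((\<lambda>u. ?g u - A * u) has_real_derivative d) (at x) \<and> 0 \<le> d"
          using x1 by (intro exI[of _ "?g' x - A"]) auto
      qed
      then show ?thesis by (simp add: algebra_simps)
    qed
  qed
qed

text \<open>The exponential of \<open>log_phi_increment\<close>: phi(R) / R^A is eventually
  nondecreasing for every A. Monotonicity, doubling, gaps and superpolynomial growth are all read
  off from this.\<close>

lemma phi_growth:
  assumes "(y, z) \<in> Theta"
  shows "\<exists>R0\<ge>3. \<forall>R R'. R0 \<le> R \<longrightarrow> R \<le> R' \<longrightarrow> (R' / R) ^ A * phi y z R \<le> phi y z R'"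
proof -
  obtain u0 where u0: "u0 > 1" "\<And>u u' :: real. u0 \<le> u \<Longrightarrow> u \<le> u' \<Longrightarrow>
    u powr (1 + y) * ln u powr z + A * (u' - u) \<le> u' powr (1 + y) * ln u' powr z"
    using log_phi_increment[OF assms, of A] by metis
  show ?thesis
  proof (intro exI[of _ "max 3 (exp u0)"] conjI allI impI)
    fix R R' :: real assume R: "max 3 (exp u0) \<le> R" "R \<le> R'"
    then have pos: "R > 0" "R' > 0" by auto
    have "u0 \<le> ln R" using R pos by (simp add: ln_ge_iff)
    moreover have "ln R \<le> ln R'" using R pos by simp
    ultimately have "ln (phi y z R) + A * (ln R' - ln R) \<le> ln (phi y z R')"
      unfolding ln_phi by (rule u0)
    then have "exp (ln (phi y z R) + A * (ln R' - ln R)) \<le> exp (ln (phi y z R'))" by simp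
    moreover have "exp (ln (phi y z R) + A * (ln R' - ln R)) = (R' / R) ^ A * phi y z R"
    proof -
      have "exp (ln R' - ln R) = R' / R" unfolding exp_diff using pos by (simp only: exp_ln)
      then have "exp (real A * (ln R' - ln R)) = (R' / R) ^ A"
        by (simp only: exp_of_nat_mult)
      moreover have "exp (ln (phi y z R)) = phi y z R" using phi_ge_1[of y z R] by simp
      ultimately show ?thesis by (simp only: exp_add mult.commute)
    qed
    ultimately show "(R' / R) ^ A * phi y z R \<le> phi y z R'" using phi_ge_1[of y z R'] by simp
  qed auto
qed

text \<open>The quotient of the logarithms tends to \<open>real L powr (1 + y)\<close>, so any
  larger \<open>E\<close> works. This upper bound on the growth keeps the position of a window
  polynomial in its length.\<close>

lemma phi_power_argument:
  assumes "(y, z) \<in> Theta" and L: "L > 0"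
  shows "\<exists>E. \<forall>\<^sub>F R in at_top. phi y z (R ^ L) \<le> phi y z R ^ E"
proof -
  obtain E where E: "real E > real L powr (1 + y)" using reals_Archimedean2 by blast
  have "((\<lambda>u. (real L * u) powr (1 + y) * ln (real L * u) powr z / (u powr (1 + y) * ln u powr z)) \<longlongrightarrow> real L powr (1 + y)) at_top"
  proof (rule Lim_transform_eventually)
    have "((\<lambda>u. ln (real L * u) / ln u) \<longlongrightarrow> 1) at_top" using L by real_asymp
    then have "((\<lambda>u. real L powr (1 + y) * (ln (real L * u) / ln u) powr z) \<longlongrightarrow> real L powr (1 + y) * 1 powr z) at_top"
      by (intro tendsto_intros) auto
    then show "((\<lambda>u. real L powr (1 + y) * (ln (real L * u) / ln u) powr z) \<longlongrightarrow> real L powr (1 + y)) at_top" by simp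
    show "\<forall>\<^sub>F u in at_top. real L powr (1 + y) * (ln (real L * u) / ln u) powr z =
      (real L * u) powr (1 + y) * ln (real L * u) powr z / (u powr (1 + y) * ln u powr z)"
      using eventually_gt_at_top[of 1]
    proof eventually_elim
      case (elim u)
      have "1 * 1 < real L * u" using L elim by (intro mult_le_less_imp_less) auto
      then have "ln (real L * u) > 0" by simp
      then show ?case using elim by (simp add: powr_mult powr_divide)
    qed
  qed
  then have "\<forall>\<^sub>F u in at_top. (real L * u) powr (1 + y) * ln (real L * u) powr z / (u powr (1 + y) * ln u powr z) < E"
    using E by (rule order_tendstoD)
  then have "\<forall>\<^sub>F R in at_top. (real L * ln R) powr (1 + y) * ln (real L * ln R) powr z / (ln R powr (1 + y) * ln (ln R) powr z) < E"
    using ln_at_top by (rule eventually_compose_filterlim)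
  then show ?thesis
  proof (intro exI[of _ E])
    assume "\<forall>\<^sub>F R in at_top. (real L * ln R) powr (1 + y) * ln (real L * ln R) powr z / (ln R powr (1 + y) * ln (ln R) powr z) < E"
    then show "\<forall>\<^sub>F R in at_top. phi y z (R ^ L) \<le> phi y z R ^ E"
      using eventually_gt_at_top[of 3]
    proof eventually_elim
      case (elim R)
      have "ln R > 1" 
      proof -
        have "ln (exp 1) < ln R" using elim(2) exp_le by (subst ln_less_cancel_iff) auto
        then show ?thesis by simp
      qed
      then have pos: "ln R powr (1 + y) * ln (ln R) powr z > 0" by simp
      have lnp: "ln (R ^ L) = real L * ln R" using elim(2) by (simp add: ln_realpow)
      have "ln (phi y z (R ^ L)) \<le> E * ln (phi y z R)"
        using elim(1) pos unfolding ln_phi lnp by (simp add: divide_less_eq)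
      also have "\<dots> = ln (phi y z R ^ E)" using phi_ge_1[of y z R] by (simp add: ln_realpow)
      finally show ?case using phi_ge_1[of y z R] phi_ge_1[of y z "R ^ L"]
        by (subst (asm) ln_le_cancel_iff) auto
    qed
  qed
qed

text \<open>\<open>ln (phi y z R)\<close> is only polylogarithmic in \<open>R\<close>. The affine
  expression has the shape of the count in \<open>card_pow_seq_le\<close>, whose \<open>J\<close>-th
  power has to stay below t.\<close>

lemma log_phi_subpolynomial:
  assumes "(y, z) \<in> Theta" and C: "C > 0"
  shows "\<forall>\<^sub>F R in at_top. (C * ln (phi y z R) + C) ^ J \<le> R"
proof -
  have yJ: "y \<ge> 0" using assms by (auto simp: Theta_def)
  have "\<forall>\<^sub>F u in at_top. (C * (u powr (1 + y) * ln u powr z) + C) ^ J \<le> exp u"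
  proof (cases "J = 0")
    case False
    with yJ have "real J > 0" by simp
    with C yJ have "\<forall>\<^sub>F u in at_top. (C * (u powr (1 + y) * ln u powr z) + C) powr real J \<le> exp u"
      by real_asymp
    then show ?thesis
    proof eventually_elim
      case (elim u)
      have "C * (u powr (1 + y) * ln u powr z) + C > 0" using C by (intro add_nonneg_pos) auto
      with elim show ?case by (simp add: powr_realpow)
    qed
  qed (use eventually_ge_at_top[of 0] in \<open>auto elim: eventually_mono\<close>)
  then have "\<forall>\<^sub>F R in at_top. (C * (ln R powr (1 + y) * ln (ln R) powr z) + C) ^ J \<le> exp (ln R)"
    using ln_at_top by (rule eventually_compose_filterlim)
  then show ?thesis using eventually_gt_at_top[of 0]
    by eventually_elim (simp add: ln_phi)
qed

lemma phi_at_top: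
  assumes "(y, z) \<in> Theta"
  shows "filterlim (phi y z) at_top at_top"
proof -
  obtain R0 where R0: "R0 \<ge> 3" "\<And>R R'. R0 \<le> R \<Longrightarrow> R \<le> R' \<Longrightarrow> (R' / R) ^ 1 * phi y z R \<le> phi y z R'"
    using phi_growth[OF assms, of 1] by metis
  show ?thesis
  proof (rule filterlim_at_top_mono)
    show "filterlim (\<lambda>R. R / R0) at_top at_top" using R0(1) by real_asymp
    show "\<forall>\<^sub>F R in at_top. R / R0 \<le> phi y z R"
      using eventually_ge_at_top[of R0]
    proof eventually_elim
      case (elim R)
      have "R / R0 * 1 \<le> R / R0 * phi y z R0" using R0(1) elim phi_ge_1 by (intro mult_left_mono) auto
      then show ?case using R0(2)[of R0 R] elim by simp
    qed
  qed
qed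

text \<open>The value \<open>0\<close> at index \<open>0\<close> accounts for the leading \<open>1\<close> of \<^const>\<open>xi\<close>; in \<open>pow_seq\<close> it is
  added artificially, because the arguments about supports need the exponent \<open>0\<close> (the first
  exponent \<open>\<lfloor>x ^ 0\<rfloor>\<close> is \<open>1\<close>). The second number of the theorem is thereby shifted by \<open>1\<close>.\<close>

definition phi_seq :: "real \<Rightarrow> real \<Rightarrow> nat \<Rightarrow> nat" where
  "phi_seq y z m = (case m of 0 \<Rightarrow> 0 | Suc i \<Rightarrow> nat \<lfloor>phi y z (real (i + 3))\<rfloor>)"

definition pow_seq :: "real \<Rightarrow> nat \<Rightarrow> nat" where
  "pow_seq x m = (case m of 0 \<Rightarrow> 0 | Suc i \<Rightarrow> nat \<lfloor>x ^ i\<rfloor>)"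

lemma floor_phi_mem_range:
  assumes "R \<ge> 3"
  shows "nat \<lfloor>phi y z (real R)\<rfloor> \<in> range (phi_seq y z)"
proof
  show "nat \<lfloor>phi y z (real R)\<rfloor> = phi_seq y z (Suc (R - 3))" using assms by (simp add: phi_seq_def)
qed simp

section \<open>Gaps between the values of \<open>phi\<close> and clusters of their sums\<close>

lemma phi_mono_doubling:
  assumes "(y, z) \<in> Theta"
  shows "\<exists>R0\<ge>3. \<forall>R. R0 \<le> R \<longrightarrow> (\<forall>R'\<ge>R. phi y z R \<le> phi y z R') \<and> 2 * phi y z R \<le> phi y z (2 * R)"
proof -
  obtain R0 where R0: "R0 \<ge> 3" "\<And>R R' :: real. R0 \<le> R \<Longrightarrow> R \<le> R' \<Longrightarrow> (R' / R) ^ 1 * phi y z R \<le> phi y z R'"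
    using phi_growth[OF assms, of 1] by metis
  show ?thesis
  proof (intro exI[of _ R0] conjI allI impI)
    fix R R' assume R: "R0 \<le> R" "R \<le> R'"
    have "1 * phi y z R \<le> R' / R * phi y z R" using R R0(1) phi_ge_1[of y z R] by (intro mult_right_mono) auto
    then show "phi y z R \<le> phi y z R'" using R0(2)[OF R] by simp
  next
    fix R assume "R0 \<le> R"
    then show "2 * phi y z R \<le> phi y z (2 * R)" using R0(1) R0(2)[of R "2 * R"] by simp
  qed (rule R0)
qed

text \<open>From \<open>R\<close> to a larger integer \<open>phi\<close> grows by at least phi(R) /
  R, and for R near t^(b+1) this exceeds every fixed multiple of phi(4 t^b) needed here. The factor
  4 is two doublings: arguments at a level go up to twice its base point, and adding all lower
  levels costs at most another doubling of the argument.\<close>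

lemma phi_gaps:
  assumes "(y, z) \<in> Theta"
  shows "\<exists>t0. \<forall>t::nat. \<forall>b. t0 \<le> t \<longrightarrow> 1 \<le> b \<longrightarrow> b < B \<longrightarrow>
    phi y z (real t) \<le> phi y z (4 * real t ^ b) \<and>
    (\<forall>R::nat. t ^ (b + 1) \<le> R \<longrightarrow> R \<le> 2 * t ^ (b + 1) \<longrightarrow>
       phi y z (real R) + phi y z (4 * real t ^ b) \<le> phi y z (4 * real t ^ (b + 1)) \<and>
       (\<forall>R'>R. phi y z (real R) + 2 * phi y z (4 * real t ^ b) + 2 \<le> phi y z (real R')))"
proof -
  obtain R1 where R1: "R1 \<ge> 3" "\<And>R R'. R1 \<le> R \<Longrightarrow> R \<le> R' \<Longrightarrow> phi y z R \<le> phi y z R'"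
    "\<And>R. R1 \<le> R \<Longrightarrow> 2 * phi y z R \<le> phi y z (2 * R)"
    using phi_mono_doubling[OF assms] by metis
  \<comment> \<open>For \<open>t \<ge> 16\<close> the square of \<open>t / 4\<close> is at least
    \<open>t\<close>, so the ratio \<open>T / (4 * t ^ b) = t / 4\<close> raised to \<open>A\<close>
    is at least \<open>t ^ (B + 1)\<close>. This dominates \<open>16 * T\<close> for all
    \<open>b < B\<close> at once.\<close>
  define A where "A = 2 * (B + 1)"
  obtain R0 where R0: "R0 \<ge> 3" "\<And>R R' :: real. R0 \<le> R \<Longrightarrow> R \<le> R' \<Longrightarrow> (R' / R) ^ A * phi y z R \<le> phi y z R'"
    using phi_growth[OF assms, of A] by metis
  define t0 where "t0 = max 16 (nat \<lceil>max R0 R1\<rceil>)"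
  show ?thesis
  proof (intro exI[of _ t0] allI impI)
    fix t b :: nat assume tb: "t0 \<le> t" "1 \<le> b" "b < B"
    have t: "real t \<ge> 16" "real t \<ge> R0" "real t \<ge> R1" using tb(1) unfolding t0_def by linarith+
    have tpos: "real t > 0" "real t \<ge> 1" using t by auto
    define p where "p = phi y z (4 * real t ^ b)"
    define T where "T = real t ^ (b + 1)"
    have p1: "p \<ge> 1" unfolding p_def by (rule phi_ge_1)
    have tle: "real t \<le> real t ^ b" using tb(2) tpos by (intro self_le_power) auto
    then have tle4: "real t \<le> 4 * real t ^ b" using tpos by linarith
    have TT: "T = real t * real t ^ b" by (simp add: T_def)
    have T4: "4 * (4 * real t ^ b) \<le> T" using t(1) unfolding TT by (simp add: mult_right_mono)
    have "real t ^ (B + 1) * p \<le> (real t / 4) ^ A * p"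
    proof (rule mult_right_mono)
      have "real t * 16 \<le> real t * real t" using t by (intro mult_left_mono) auto
      then have "real t \<le> (real t / 4)\<^sup>2" by (simp add: power2_eq_square)
      then have "real t ^ (B + 1) \<le> ((real t / 4)\<^sup>2) ^ (B + 1)" using tpos by (intro power_mono) auto
      then show "real t ^ (B + 1) \<le> (real t / 4) ^ A" unfolding A_def power_mult .
    qed (use p1 in simp)
    also have "(real t / 4) ^ A * p = (T / (4 * real t ^ b)) ^ A * p"
      using tpos by (simp add: TT)
    also have "\<dots> \<le> phi y z T" unfolding p_def by (rule R0(2)) (use t tle4 T4 tpos in auto)
    finally have phiT: "real t ^ (B + 1) * p \<le> phi y z T" .
    have "16 * T \<le> real t * T" using t by (intro mult_right_mono) (auto simp: T_def)
    also have "\<dots> = real t ^ (b + 2)" by (simp add: T_def)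
    also have "\<dots> \<le> real t ^ (B + 1)" using tb(3) tpos by (intro power_increasing) auto
    finally have T16: "16 * T \<le> real t ^ (B + 1)" .
    have Tpos: "T > 0" using tpos by (simp add: T_def)
    have "16 * T * p \<le> real t ^ (B + 1) * p" using T16 p1 by (intro mult_right_mono) auto
    with phiT have Tp: "16 * T * p \<le> phi y z T" by linarith
    have tT: "real t \<le> T" using tle4 T4 tpos by simp
    show "phi y z (real t) \<le> phi y z (4 * real t ^ b) \<and>
      (\<forall>R::nat. t ^ (b + 1) \<le> R \<longrightarrow> R \<le> 2 * t ^ (b + 1) \<longrightarrow>
       phi y z (real R) + phi y z (4 * real t ^ b) \<le> phi y z (4 * real t ^ (b + 1)) \<and>
       (\<forall>R'>R. phi y z (real R) + 2 * phi y z (4 * real t ^ b) + 2 \<le> phi y z (real R')))"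
    proof (intro conjI allI impI)
      show "phi y z (real t) \<le> phi y z (4 * real t ^ b)" by (rule R1(2)) (use t tle4 in auto)
    next
      fix R :: nat assume R: "t ^ (b + 1) \<le> R" "R \<le> 2 * t ^ (b + 1)"
      have RT: "T \<le> real R" "real R \<le> 2 * T" using R unfolding T_def by (metis of_nat_le_iff of_nat_power, metis of_nat_le_iff of_nat_mult of_nat_power of_nat_numeral)
      have "phi y z (real R) \<le> phi y z (2 * T)" by (rule R1(2)) (use RT t tT in auto)
      moreover have "phi y z (4 * real t ^ b) \<le> phi y z (2 * T)" by (rule R1(2)) (use T4 Tpos t tle4 in auto)
      moreover have "2 * phi y z (2 * T) \<le> phi y z (2 * (2 * T))" by (rule R1(3)) (use Tpos t tT in auto)
      ultimately show "phi y z (real R) + phi y z (4 * real t ^ b) \<le> phi y z (4 * real t ^ (b + 1))"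
        by (simp add: T_def)
      fix R' assume R': "R < R'"
      have Rpos: "real R > 0" using RT Tpos by simp
      have q: "phi y z T \<le> phi y z (real R)" by (rule R1(2)) (use RT t tT in auto)
      have "phi y z (real R) + 4 * p \<le> (1 + 1 / real R) * phi y z (real R)"
      proof -
        have "4 * p * real R \<le> 4 * p * (2 * T)" using RT p1 by (intro mult_left_mono) auto
        also have "\<dots> \<le> 16 * T * p" using Tpos p1 by simp
        also have "\<dots> \<le> phi y z (real R)" using Tp q by simp
        finally have "4 * p \<le> phi y z (real R) / real R" using Rpos by (simp add: field_simps)
        then show ?thesis by (simp add: algebra_simps)
      qed
      also have "\<dots> \<le> (real R' / real R) ^ A * phi y z (real R)"
      proof (rule mult_right_mono)
        have "real R + 1 \<le> real R'" using R' by linarith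
        then have ge: "1 + 1 / real R \<le> real R' / real R" using Rpos by (simp add: field_simps)
        also have "\<dots> \<le> (real R' / real R) ^ A"
          using R' Rpos by (intro self_le_power) (auto simp: A_def)
        finally show "1 + 1 / real R \<le> (real R' / real R) ^ A" .
      qed (use phi_ge_1[of y z "real R"] in simp)
      also have "\<dots> \<le> phi y z (real R')" by (rule R0(2)) (use RT t tT R' in auto)
      finally show "phi y z (real R) + 2 * phi y z (4 * real t ^ b) + 2 \<le> phi y z (real R')"
        using p1 unfolding p_def by linarith
    qed
  qed
qed

text \<open>The \<open>j\<close>-fold sums take one argument from a block of \<open>t ^ b0\<close> integers starting at
  \<open>t ^ (b0 + 1)\<close>, one from a block at \<open>t ^ (b0 + 2)\<close>, and so on; the gaps at each level exceed
  all sums of the lower levels.\<close>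

lemma separated_cluster:
  assumes t: "t \<ge> 3" and b0: "b0 \<ge> 1" and supp: "fps_support (count_fps (phi_seq y z)) = range (phi_seq y z)"
    and gaps: "\<And>b. 1 \<le> b \<Longrightarrow> b < B \<Longrightarrow>
    phi y z (real t) \<le> phi y z (4 * real t ^ b) \<and>
    (\<forall>R::nat. t ^ (b + 1) \<le> R \<longrightarrow> R \<le> 2 * t ^ (b + 1) \<longrightarrow>
       phi y z (real R) + phi y z (4 * real t ^ b) \<le> phi y z (4 * real t ^ (b + 1)) \<and>
       (\<forall>R'>R. phi y z (real R) + 2 * phi y z (4 * real t ^ b) + 2 \<le> phi y z (real R')))"
    and "b0 + j \<le> B"
  shows "\<exists>E \<subseteq> fps_support (count_fps (phi_seq y z) ^ j). finite E \<and> card E = (t ^ b0) ^ j \<and>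
    (\<forall>s\<in>E. real s \<le> phi y z (4 * real t ^ (b0 + j))) \<and>
    (\<forall>s\<in>E. \<forall>s'\<in>E. s < s' \<longrightarrow> real s + phi y z (real t) < real s')"
  using assms(5)
proof (induction j)
  case 0
  show ?case using phi_ge_1[of y z "4 * real t ^ b0"]
    by (intro exI[of _ "{0}"]) (auto simp: fps_support_def)
next
  case (Suc j)
  let ?f = "phi y z" and ?S = "count_fps (phi_seq y z)"
  obtain E where E: "E \<subseteq> fps_support (?S ^ j)" "finite E" "card E = (t ^ b0) ^ j"
    "\<And>s. s \<in> E \<Longrightarrow> real s \<le> ?f (4 * real t ^ (b0 + j))"
    "\<And>s s'. s \<in> E \<Longrightarrow> s' \<in> E \<Longrightarrow> s < s' \<Longrightarrow> real s + ?f (real t) < real s'"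
    using Suc by auto
  define b where "b = b0 + j"
  have b: "1 \<le> b" "b < B" using b0 Suc.prems by (auto simp: b_def)
  note g = gaps[OF b]
  define Blk where "Blk = {t ^ (b + 1)..<t ^ (b + 1) + t ^ b0}"
  define u where "u = (\<lambda>R::nat. nat \<lfloor>?f (real R)\<rfloor>)"
  have blk: "t ^ (b + 1) \<le> R" "R \<le> 2 * t ^ (b + 1)" "R \<ge> 3" if "R \<in> Blk" for R
  proof -
    have "t ^ b0 \<le> t ^ (b + 1)" using t by (intro power_increasing) (auto simp: b_def)
    moreover have "t ^ 1 \<le> t ^ (b + 1)" using t by (intro power_increasing) auto
    moreover have "t ^ (b + 1) \<le> R" "R < t ^ (b + 1) + t ^ b0" using that unfolding Blk_def by auto
    ultimately show "t ^ (b + 1) \<le> R" "R \<le> 2 * t ^ (b + 1)" "R \<ge> 3" using t unfolding power_one_right by linarith+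
  qed
  have ule: "real (u R) \<le> ?f (real R)" "?f (real R) - 1 < real (u R)" for R
    unfolding u_def using phi_ge_1[of y z "real R"] by linarith+
  \<comment> \<open>Different arguments at the top level separate the sums whatever the lower parts:
    one copy of phi(4 t^b) in the gap covers \<open>s\<close>, the other covers phi(t), and the
    constant 2 covers the rounding; \<open>s'\<close> only adds.\<close>
  have far: "real (u R + s) + ?f (real t) < real (u R' + s')"
    if "R \<in> Blk" "R < R'" "s \<in> E" for R R' s s'
  proof -
    have "?f (real R) + 2 * ?f (4 * real t ^ b) + 2 \<le> ?f (real R')" using g blk[OF that(1)] that(2) by blast
    moreover have "real s \<le> ?f (4 * real t ^ b)" using E(4)[OF that(3)] by (simp add: b_def)
    moreover have "?f (real t) \<le> ?f (4 * real t ^ b)" using g by blast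
    ultimately show ?thesis using ule(1)[of R] ule(2)[of R'] by simp
  qed
  have sep: "real (u R + s) + ?f (real t) < real (u R' + s')"
    if "(R, s) \<in> Blk \<times> E" "(R', s') \<in> Blk \<times> E" "u R + s < u R' + s'" for R R' s s'
  proof (cases R R' rule: linorder_cases)
    case less
    then show ?thesis using far that by auto
  next
    case equal
    then show ?thesis using E(5)[of s s'] that by auto
  next
    case greater
    then have "real (u R' + s') + ?f (real t) < real (u R + s)" using far that by auto
    then have "real (u R' + s') < real (u R + s)" using phi_ge_1[of y z "real t"] by linarith
    then show ?thesis using that(3) by linarith
  qed
  define h where "h = (\<lambda>(R, s). u R + s)"
  have inj: "inj_on h (Blk \<times> E)"
  proof (rule inj_onI)
    fix x x' assume x: "x \<in> Blk \<times> E" "x' \<in> Blk \<times> E" "h x = h x'"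
    obtain R s R' s' where xs: "x = (R, s)" "x' = (R', s')" by (metis surj_pair)
    have "R = R'"
    proof (rule ccontr)
      assume "R \<noteq> R'"
      then consider "R < R'" | "R' < R" by linarith
      then show False
      proof cases
        case 1
        then show False using far[of R R' s s'] x phi_ge_1[of y z "real t"] unfolding xs h_def by auto
      next
        case 2
        then show False using far[of R' R s' s] x phi_ge_1[of y z "real t"] unfolding xs h_def by auto
      qed
    qed
    then show "x = x'" using x(3) unfolding xs h_def by simp
  qed
  show ?case
  proof (intro exI[of _ "h ` (Blk \<times> E)"] conjI ballI impI)
    show "h ` (Blk \<times> E) \<subseteq> fps_support (?S ^ Suc j)"
    proof
      fix n assume "n \<in> h ` (Blk \<times> E)"
      then obtain R s where n: "n = u R + s" "R \<in> Blk" "s \<in> E" by (auto simp: h_def)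
      have "u R \<in> fps_support ?S" unfolding supp u_def by (rule floor_phi_mem_range[OF blk(3)[OF n(2)]])
      then show "n \<in> fps_support (?S ^ Suc j)"
        using fps_support_multI[OF count_fps_nonneg fps_power_nonneg[OF count_fps_nonneg]] E(1) n by auto
    qed
    show "finite (h ` (Blk \<times> E))" using E(2) by (simp add: Blk_def)
    show "card (h ` (Blk \<times> E)) = (t ^ b0) ^ Suc j"
      unfolding card_image[OF inj] card_cartesian_product E(3) by (simp add: Blk_def)
  next
    fix n assume "n \<in> h ` (Blk \<times> E)"
    then obtain R s where n: "n = u R + s" "R \<in> Blk" "s \<in> E" by (auto simp: h_def)
    have "?f (real R) + ?f (4 * real t ^ b) \<le> ?f (4 * real t ^ (b + 1))" using g blk[OF n(2)] by blast
    then show "real n \<le> ?f (4 * real t ^ (b0 + Suc j))"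
      using E(4)[OF n(3)] ule(1)[of R] unfolding n(1) by (simp add: b_def)
  next
    fix n n' assume "n \<in> h ` (Blk \<times> E)" "n' \<in> h ` (Blk \<times> E)" "n < n'"
    then show "real n + ?f (real t) < real n'" using sep by (auto simp: h_def)
  qed
qed

section \<open>The two exponent sequences: growth, spacing and separation\<close>

lemma superpolynomial_phi_seq:
  assumes "(y, z) \<in> Theta"
  shows "superpolynomial (phi_seq y z)"
  unfolding superpolynomial_def
proof
  fix A
  \<comment> \<open>The spare power of \<open>R\<close> will absorb the constant
    \<open>R0 ^ (A + 1)\<close>.\<close>
  obtain R0 where R0: "R0 \<ge> 3" "\<And>R R' :: real. R0 \<le> R \<Longrightarrow> R \<le> R' \<Longrightarrow> (R' / R) ^ (A + 1) * phi y z R \<le> phi y z R'"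
    using phi_growth[OF assms, of "A + 1"] by metis
  show "\<exists>m0. \<forall>m\<ge>m0. m ^ A \<le> phi_seq y z m"
  proof (intro exI[of _ "nat \<lceil>R0 ^ (A + 1)\<rceil> + 1"] allI impI)
    fix m assume m: "nat \<lceil>R0 ^ (A + 1)\<rceil> + 1 \<le> m"
    then obtain i where i: "m = Suc i" by (cases m) auto
    define R where "R = real (i + 3)"
    have "R0 ^ (A + 1) \<le> real m" using m by linarith
    then have RA: "R0 ^ (A + 1) \<le> R" by (simp add: R_def i)
    have "R0 ^ 1 \<le> R0 ^ (A + 1)" using R0(1) by (intro power_increasing) auto
    then have R: "R0 \<le> R" using RA by simp
    have "R ^ A * 1 \<le> R ^ A * (R / R0 ^ (A + 1))" using RA R0(1) by (intro mult_left_mono) (auto simp: R_def)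
    also have "\<dots> = (R / R0) ^ (A + 1)" by (simp add: power_divide)
    also have "\<dots> = (R / R0) ^ (A + 1) * 1" by simp
    also have "\<dots> \<le> (R / R0) ^ (A + 1) * phi y z R0" using R R0(1) phi_ge_1[of y z R0] by (intro mult_left_mono) auto
    also have "\<dots> \<le> phi y z R" using R by (intro R0(2)) auto
    finally have "R ^ A \<le> phi y z R" by simp
    moreover have "real (m ^ A) \<le> R ^ A" unfolding of_nat_power by (intro power_mono) (auto simp: R_def i)
    ultimately have "real (m ^ A) \<le> phi y z R" by linarith
    then have "int (m ^ A) \<le> \<lfloor>phi y z R\<rfloor>" by (simp add: le_floor_iff)
    then have "m ^ A \<le> nat \<lfloor>phi y z R\<rfloor>" by linarith
    then show "m ^ A \<le> phi_seq y z m" by (simp add: phi_seq_def i R_def)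
  qed
qed

lemma superpolynomial_pow_seq:
  assumes "x > 1"
  shows "superpolynomial (pow_seq x)"
  unfolding superpolynomial_def
proof
  fix A
  have "(\<lambda>n. real (Suc n) ^ A * (1 / x) ^ n) \<longlonglongrightarrow> 0"
    by (rule summable_LIMSEQ_zero[OF summable_Suc_power_geometric]) (use assms in auto)
  then have "\<forall>\<^sub>F n in sequentially. real (Suc n) ^ A * (1 / x) ^ n < 1" by (rule order_tendstoD) auto
  then obtain n0 where n0: "\<And>n. n \<ge> n0 \<Longrightarrow> real (Suc n) ^ A * (1 / x) ^ n < 1"
    unfolding eventually_sequentially by blast
  show "\<exists>m0. \<forall>m\<ge>m0. m ^ A \<le> pow_seq x m"
  proof (intro exI[of _ "Suc n0"] allI impI)
    fix m assume "Suc n0 \<le> m"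
    then obtain i where i: "m = Suc i" "i \<ge> n0" by (cases m) auto
    have "real (m ^ A) < x ^ i" using n0[OF i(2)] assms by (simp add: i(1) field_simps)
    then have "int (m ^ A) \<le> \<lfloor>x ^ i\<rfloor>" by (simp add: le_floor_iff)
    then have "m ^ A \<le> nat \<lfloor>x ^ i\<rfloor>" by linarith
    then show "m ^ A \<le> pow_seq x m" by (simp add: pow_seq_def i(1))
  qed
qed

text \<open>The least power of \<open>x\<close> that reaches \<open>N\<close> is at most
  \<open>x * N\<close>, and taking the floor keeps it at least \<open>N\<close> because
  \<open>N\<close> is an integer.\<close>

lemma boundedly_spaced_pow_seq:
  assumes "x > 1"
  shows "boundedly_spaced (pow_seq x)"
  unfolding boundedly_spaced_def
proof (rule exI[of _ "nat \<lceil>x\<rceil>"], rule exI[of _ 1], intro allI impI)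
  fix N :: nat assume N: "1 \<le> N"
  define i where "i = (LEAST i. real N \<le> x ^ i)"
  have ex: "\<exists>i. real N \<le> x ^ i" using real_arch_pow[OF assms, of "real N"] by (auto intro: less_imp_le)
  have i: "real N \<le> x ^ i" unfolding i_def by (rule LeastI_ex[OF ex])
  have "x ^ i \<le> x * real N"
  proof (cases i)
    case 0
    have "1 * 1 \<le> x * real N" using assms N by (intro mult_mono) auto
    with 0 show ?thesis by simp
  next
    case (Suc j)
    then have "\<not> real N \<le> x ^ j" using not_less_Least[of j "\<lambda>i. real N \<le> x ^ i"] by (simp add: i_def)
    then have "x * x ^ j \<le> x * real N" using assms by (intro mult_left_mono) auto
    with Suc show ?thesis by simp
  qed
  also have "\<dots> \<le> real (nat \<lceil>x\<rceil>) * real N" using real_nat_ceiling_ge by (intro mult_right_mono) auto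
  finally have "x ^ i \<le> real (nat \<lceil>x\<rceil> * N)" by simp
  then have "nat \<lfloor>x ^ i\<rfloor> \<le> nat \<lceil>x\<rceil> * N" by (metis floor_mono floor_of_nat nat_int nat_mono)
  moreover have "N \<le> nat \<lfloor>x ^ i\<rfloor>" using i by (simp add: le_nat_iff le_floor_iff)
  ultimately show "\<exists>m. N \<le> pow_seq x m \<and> pow_seq x m \<le> nat \<lceil>x\<rceil> * N"
    by (intro exI[of _ "Suc i"]) (simp add: pow_seq_def)
qed

lemma card_pow_seq_le:
  assumes "x > 1"
  shows "\<exists>C>0. \<forall>N. real (card {m. pow_seq x m \<le> N}) \<le> C * ln (real N + 1) + C"
proof -
  \<comment> \<open>One constant serves as slope and as offset, as
    \<open>log_phi_subpolynomial\<close> expects; the 2 accounts for the rounding up in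
    \<open>L\<close> and for the index 0.\<close>
  define C where "C = 1 / ln x + 2"
  have lx: "ln x > 0" using assms by simp
  show ?thesis
  proof (intro exI[of _ C] conjI allI)
    show "C > 0" using lx by (simp add: C_def add_pos_pos)
    fix N
    define L where "L = nat \<lceil>ln (real N + 1) / ln x\<rceil>"
    have "{m. pow_seq x m \<le> N} \<subseteq> {..<Suc L}"
    proof
      fix m assume m: "m \<in> {m. pow_seq x m \<le> N}"
      show "m \<in> {..<Suc L}"
      proof (cases m)
        case (Suc i)
        then have "nat \<lfloor>x ^ i\<rfloor> \<le> N" using m by (simp add: pow_seq_def)
        then have "\<lfloor>x ^ i\<rfloor> < int N + 1" by linarith
        then have "x ^ i < real N + 1" by linarith
        then have "ln (x ^ i) < ln (real N + 1)" using assms by (subst ln_less_cancel_iff) auto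
        then have "real i < ln (real N + 1) / ln x" using assms lx by (simp add: ln_realpow field_simps)
        then have "i < L" unfolding L_def by linarith
        with Suc show ?thesis by simp
      qed simp
    qed
    then have "card {m. pow_seq x m \<le> N} \<le> card {..<Suc L}" by (intro card_mono) auto
    then have "real (card {m. pow_seq x m \<le> N}) \<le> real L + 1" by simp
    also have "\<dots> \<le> ln (real N + 1) / ln x + 2"
    proof -
      have "ln (real N + 1) / ln x \<ge> 0" using lx by simp
      then show ?thesis unfolding L_def by linarith
    qed
    also have "\<dots> \<le> C * ln (real N + 1) + C"
    proof -
      have "ln (real N + 1) / ln x \<le> C * ln (real N + 1)"
        using lx by (simp add: C_def algebra_simps)
      moreover have "C \<ge> 2" using lx by (simp add: C_def)
      ultimately show ?thesis by linarith
    qed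
    finally show "real (card {m. pow_seq x m \<le> N}) \<le> C * ln (real N + 1) + C" .
  qed
qed

text \<open>The windows of length phi(t) to the right of the cluster points are pairwise disjoint
  and stay below phi(t^c). If each of them met the support of \<open>S ^ k * T ^ J\<close>, that
  support would have at least as many points there as the cluster.\<close>

lemma separated_phi_pow:
  assumes yz: "(y, z) \<in> Theta" and x: "x > 1"
  shows "separated (phi_seq y z) (pow_seq x)"
  unfolding separated_def
proof (intro allI)
  fix k J :: nat
  let ?f = "phi y z" and ?v = "phi_seq y z" and ?w = "pow_seq x"
  have spv: "superpolynomial ?v" and spw: "superpolynomial ?w"
    using superpolynomial_phi_seq[OF yz] superpolynomial_pow_seq[OF x] .
  \<comment> \<open>Chosen so that the cluster of \<open>t ^ (b0 * Suc k)\<close> sums beats the at most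
    \<open>t ^ ((c + 1) * k + 1)\<close> exponents of \<open>S ^ k * T ^ J\<close> in its range.\<close>
  define b0 where "b0 = k ^ 2 + 3 * k + 2"
  define c where "c = b0 + k + 2"
  obtain C where C: "C > 0" "\<And>N. real (card {m. ?w m \<le> N}) \<le> C * ln (real N + 1) + C"
    using card_pow_seq_le[OF x] by metis
  obtain t0 where gaps: "\<And>t b. t0 \<le> t \<Longrightarrow> 1 \<le> b \<Longrightarrow> b < c \<Longrightarrow>
    ?f (real t) \<le> ?f (4 * real t ^ b) \<and>
    (\<forall>R::nat. t ^ (b + 1) \<le> R \<longrightarrow> R \<le> 2 * t ^ (b + 1) \<longrightarrow>
       ?f (real R) + ?f (4 * real t ^ b) \<le> ?f (4 * real t ^ (b + 1)) \<and>
       (\<forall>R'>R. ?f (real R) + 2 * ?f (4 * real t ^ b) + 2 \<le> ?f (real R')))"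
    using phi_gaps[OF yz, of c] by metis
  obtain R1 where R1: "R1 \<ge> 3" "\<And>R R'. R1 \<le> R \<Longrightarrow> R \<le> R' \<Longrightarrow> ?f R \<le> ?f R'"
    "\<And>R. R1 \<le> R \<Longrightarrow> 2 * ?f R \<le> ?f (2 * R)"
    using phi_mono_doubling[OF yz] by metis
  obtain E where E: "\<forall>\<^sub>F R in at_top. ?f (R ^ (c + 1)) \<le> ?f R ^ E"
    using phi_power_argument[OF yz, of "c + 1"] by auto
  \<comment> \<open>The range has \<open>ln (real N + 1)\<close> at most
    \<open>E * ln (phi y z t)\<close>; the factor \<open>E + 1\<close> turns the count of exponents
    of \<open>T\<close> into an affine expression in \<open>ln (phi y z t)\<close>.\<close>
  define C' where "C' = C * (real E + 1)"
  have C': "C' > 0" using C(1) by (simp add: C'_def)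
  note ev = eventually_conj[OF E eventually_conj[OF log_phi_subpolynomial[OF yz C', of J]
    filterlim_at_top[THEN iffD1, OF phi_at_top[OF yz], rule_format]]]
  show "\<exists>e. \<forall>Q0. \<exists>Q\<ge>Q0. \<exists>n0\<in>fps_support (count_fps ?v ^ Suc k). n0 \<le> (Q + 1) ^ e \<and>
    {n0..n0 + Q ^ 5} \<inter> fps_support (count_fps ?v ^ k * count_fps ?w ^ J) = {}"
  \<comment> \<open>\<open>Q\<close> will be the integral fifth root of the window length, so phi(t)
    is at most \<open>(Q + 1) ^ 5\<close> and \<open>n0\<close>, at most phi(t)^E, is at most
    \<open>(Q + 1) ^ (5 * E)\<close>.\<close>
  proof (rule exI[of _ "5 * E"], rule allI)
    fix Q0 :: nat
    have "\<forall>\<^sub>F t in sequentially. ?f (real t ^ (c + 1)) \<le> ?f (real t) ^ E \<and>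
      (C' * ln (?f (real t)) + C') ^ J \<le> real t \<and> real Q0 ^ 5 + 1 \<le> ?f (real t)"
      by (rule eventually_compose_filterlim[OF ev filterlim_real_sequentially])
    then have "\<forall>\<^sub>F t in sequentially. (?f (real t ^ (c + 1)) \<le> ?f (real t) ^ E \<and>
      (C' * ln (?f (real t)) + C') ^ J \<le> real t \<and> real Q0 ^ 5 + 1 \<le> ?f (real t)) \<and>
      t0 \<le> t \<and> 16 \<le> t \<and> nat \<lceil>R1\<rceil> \<le> t"
      by (rule eventually_conj) (intro eventually_conj eventually_ge_at_top)
    then obtain t where t: "?f (real t ^ (c + 1)) \<le> ?f (real t) ^ E"
      "(C' * ln (?f (real t)) + C') ^ J \<le> real t" "real Q0 ^ 5 + 1 \<le> ?f (real t)"
      "t0 \<le> t" "16 \<le> t" "nat \<lceil>R1\<rceil> \<le> t"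
      using eventually_happens'[OF sequentially_bot] by blast
    have tR: "R1 \<le> real t" "real t \<ge> 16" using t(5,6) by linarith+
    have b0: "1 \<le> b0" by (simp add: b0_def)
    obtain Es where Es: "Es \<subseteq> fps_support (count_fps ?v ^ Suc k)" "finite Es" "card Es = (t ^ b0) ^ Suc k"
      "\<And>s. s \<in> Es \<Longrightarrow> real s \<le> ?f (4 * real t ^ (b0 + Suc k))"
      "\<And>s s'. s \<in> Es \<Longrightarrow> s' \<in> Es \<Longrightarrow> s < s' \<Longrightarrow> real s + ?f (real t) < real s'"
      using separated_cluster[of t b0 y z c "Suc k", OF _ b0 fps_support_count_fps[OF spv] gaps[OF t(4)]] t(5)
      by (auto simp: c_def)
    define G where "G = nat \<lfloor>?f (real t)\<rfloor>"
    have G: "real G \<le> ?f (real t)" "?f (real t) < real G + 1"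
      unfolding G_def using phi_ge_1[of y z "real t"] by linarith+
    have pw: "real t ^ i \<le> real t ^ j" "real t \<le> real t ^ Suc i" if "i \<le> j" for i j
      using that tR power_increasing[of i j "real t"] self_le_power[of "real t" "Suc i"] by auto
    \<comment> \<open>\<open>c\<close> exceeds \<open>b0 + Suc k\<close> by one; the spare factor
      \<open>t\<close> absorbs the 4 in the bound for the cluster and one doubling that makes room
      for the window after its last point.\<close>
    have tc: "8 * real t ^ (b0 + Suc k) \<le> real t ^ c"
      using tR by (simp add: c_def mult_right_mono)
    have tc1: "real t \<le> real t ^ c" using pw(2)[of "c - 1" "c - 1"] by (simp add: c_def)
    have tbk: "real t \<le> real t ^ (b0 + Suc k)" using pw(2)[of "b0 + k" "b0 + k"] by simp
    have ub: "real s + ?f (real t) \<le> ?f (real t ^ c)" if "s \<in> Es" for s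
    proof -
      have "?f (real t) \<le> ?f (4 * real t ^ (b0 + Suc k))"
        by (rule R1(2)) (use tR tbk in linarith)+
      moreover have "2 * ?f (4 * real t ^ (b0 + Suc k)) \<le> ?f (2 * (4 * real t ^ (b0 + Suc k)))"
        by (rule R1(3)) (use tR tbk in linarith)
      moreover have "?f (2 * (4 * real t ^ (b0 + Suc k))) \<le> ?f (real t ^ c)"
        by (rule R1(2)) (use tR tbk tc in linarith)+
      ultimately show ?thesis using Es(4)[OF that] by linarith
    qed
    define N where "N = nat \<lfloor>?f (real t ^ c)\<rfloor>"
    have N: "real N \<le> ?f (real t ^ c)" unfolding N_def using phi_ge_1[of y z "real t ^ c"] by linarith
    have two: "?f (real t ^ c) + 1 \<le> ?f (2 * real t ^ c)"
    proof -
      have "2 * ?f (real t ^ c) \<le> ?f (2 * real t ^ c)"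
        by (rule R1(3)) (use tR tc1 in linarith)
      then show ?thesis using phi_ge_1[of y z "real t ^ c"] by linarith
    qed
    have t2c: "2 * real t ^ c \<le> real t ^ (c + 1)" using tR by (simp add: mult_right_mono)
    \<comment> \<open>From the index \<open>t ^ (c + 1)\<close> on, the argument of
      \<open>phi\<close> is at least \<open>2 * t ^ c\<close>, where \<open>phi\<close> has gained
      at least 1 over its value at \<open>t ^ c\<close>; this survives the floor.\<close>
    have cardv: "card {m. ?v m \<le> N} \<le> t ^ (c + 1)"
    proof -
      have "{m. ?v m \<le> N} \<subseteq> {..<t ^ (c + 1)}"
      proof (rule subsetI, rule ccontr)
        fix m assume m: "m \<in> {m. ?v m \<le> N}" "m \<notin> {..<t ^ (c + 1)}"
        then have mt: "t ^ (c + 1) \<le> m" by simp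
        moreover have "0 < t ^ (c + 1)" using t(5) by simp
        ultimately obtain i where i: "m = Suc i" by (cases m) auto
        have "real t ^ (c + 1) \<le> real m" using mt by (metis of_nat_le_iff of_nat_power)
        then have "2 * real t ^ c \<le> real (i + 3)" using t2c unfolding i by linarith
        then have "?f (2 * real t ^ c) \<le> ?f (real (i + 3))"
          by (intro R1(2)) (use tR tc1 in linarith)+
        then have "?f (real t ^ c) + 1 \<le> ?f (real (i + 3))" using two by linarith
        moreover have "nat \<lfloor>?f (real (i + 3))\<rfloor> \<le> N" using m(1) by (simp add: i phi_seq_def add.commute)
        ultimately show False unfolding N_def using phi_ge_1[of y z "real t ^ c"] by linarith
      qed
      then have "card {m. ?v m \<le> N} \<le> card {..<t ^ (c + 1)}" by (intro card_mono) auto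
      then show ?thesis by simp
    qed
    have cardw: "card {m. ?w m \<le> N} ^ J \<le> t"
    proof -
      have l0: "0 \<le> ln (?f (real t))" using phi_ge_1[of y z "real t"] by simp
      have "ln (real N + 1) \<le> ln (?f (real t ^ (c + 1)))"
      proof (subst ln_le_cancel_iff)
        have "?f (2 * real t ^ c) \<le> ?f (real t ^ (c + 1))"
          by (rule R1(2)) (use tR tc1 t2c in linarith)+
        then show "real N + 1 \<le> ?f (real t ^ (c + 1))" using N two by linarith
      qed (use phi_ge_1[of y z "real t ^ (c + 1)"] in auto)
      also have "\<dots> \<le> ln (?f (real t) ^ E)"
        using t(1) phi_ge_1[of y z "real t ^ (c + 1)"] by (subst ln_le_cancel_iff) auto
      also have "\<dots> = real E * ln (?f (real t))" using phi_ge_1[of y z "real t"] by (simp add: ln_realpow)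
      finally have "C * ln (real N + 1) + C \<le> C * (real E * ln (?f (real t))) + C"
        using C(1) by simp
      also have "\<dots> \<le> C' * ln (?f (real t)) + C'"
        using C(1) l0 by (simp add: C'_def algebra_simps)
      finally have "real (card {m. ?w m \<le> N}) \<le> C' * ln (?f (real t)) + C'" using C(2)[of N] by linarith
      then have "real (card {m. ?w m \<le> N}) ^ J \<le> (C' * ln (?f (real t)) + C') ^ J" by (intro power_mono) auto
      then show ?thesis using t(2) by (metis of_nat_le_iff of_nat_power order.trans)
    qed
    define B where "B = fps_support (count_fps ?v ^ k * count_fps ?w ^ J)"
    have "card (B \<inter> {..N}) \<le> card (fps_support (count_fps ?v ^ k) \<inter> {..N}) * card (fps_support (count_fps ?w ^ J) \<inter> {..N})"
      unfolding B_def by (rule card_fps_support_mult)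
    also have "\<dots> \<le> card {m. ?v m \<le> N} ^ k * card {m. ?w m \<le> N} ^ J"
      by (intro mult_mono order.trans[OF card_fps_support_power] power_mono card_fps_support_count_fps spv spw) auto
    also have "\<dots> \<le> (t ^ (c + 1)) ^ k * t"
      by (intro mult_mono power_mono cardv cardw) auto
    also have "\<dots> = t ^ ((c + 1) * k + 1)"
      unfolding power_mult[of t "c + 1" k, symmetric] by simp
    also have "\<dots> < t ^ (b0 * Suc k)"
    proof (rule power_strict_increasing)
      show "(c + 1) * k + 1 < b0 * Suc k" by (simp add: c_def b0_def power2_eq_square algebra_simps)
    qed (use t(5) in auto)
    also have "\<dots> = card Es" unfolding Es(3) by (rule power_mult)
    finally have less: "card (B \<inter> {..N}) < card Es" .
    have "\<exists>s\<in>Es. {s..s + G} \<inter> B = {}"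
    proof (rule ccontr)
      assume "\<not> ?thesis"
      then have "\<forall>s\<in>Es. \<exists>n. n \<in> {s..s + G} \<inter> B" by blast
      then obtain h where h: "\<And>s. s \<in> Es \<Longrightarrow> h s \<in> {s..s + G} \<inter> B" by metis
      have hless: "h s < h s'" if "s \<in> Es" "s' \<in> Es" "s < s'" for s s'
      proof -
        have "s + G < s'" using Es(5)[OF that] G(1) by linarith
        then show ?thesis using h[OF that(1)] h[OF that(2)] by auto
      qed
      have "inj_on h Es"
      proof (rule inj_onI)
        fix s s' assume "s \<in> Es" "s' \<in> Es" "h s = h s'"
        then show "s = s'" using hless[of s s'] hless[of s' s] by (cases s s' rule: linorder_cases) auto
      qed
      moreover have "h ` Es \<subseteq> B \<inter> {..N}"
      proof
        fix n assume "n \<in> h ` Es"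
        then obtain s where s: "s \<in> Es" "n = h s" by auto
        have "real s + real G \<le> ?f (real t ^ c)" using ub[OF s(1)] G(1) by linarith
        then have "s + G \<le> N" unfolding N_def by (simp add: le_nat_iff le_floor_iff)
        then show "n \<in> B \<inter> {..N}" using h[OF s(1)] s(2) by auto
      qed
      ultimately have "card Es \<le> card (B \<inter> {..N})" using card_inj_on_le[of h Es "B \<inter> {..N}"] by simp
      with less show False by simp
    qed
    then obtain n0 where n0: "n0 \<in> Es" "{n0..n0 + G} \<inter> B = {}" by blast
    \<comment> \<open>The condition \<open>Q0 ^ 5 + 1 \<le> phi y z t\<close> in the choice of
      \<open>t\<close> makes this root at least \<open>Q0\<close>.\<close>
    define Q where "Q = (GREATEST q. q ^ 5 \<le> G)"
    have bnd: "q \<le> G" if "q ^ 5 \<le> G" for q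
    proof (cases "q = 0")
      case False
      then have "q \<le> q ^ 5" by (intro self_le_power) auto
      with that show ?thesis by simp
    qed simp
    have Q5: "Q ^ 5 \<le> G" unfolding Q_def by (rule GreatestI_nat[of _ 0 G]) (use bnd in auto)
    have QG: "G < (Q + 1) ^ 5"
    proof (rule ccontr)
      assume "\<not> G < (Q + 1) ^ 5"
      then have "Q + 1 \<le> Q" unfolding Q_def by (intro Greatest_le_nat[of _ _ G]) (use bnd in \<open>auto simp: Q_def\<close>)
      then show False by simp
    qed
    have "real Q0 ^ 5 < real ((Q + 1) ^ 5)"
    proof -
      have "real Q0 ^ 5 < real G + 1" using t(3) G(2) by linarith
      also have "\<dots> \<le> real ((Q + 1) ^ 5)" using QG by linarith
      finally show ?thesis .
    qed
    then have "Q0 ^ 5 < (Q + 1) ^ 5" by (metis of_nat_less_iff of_nat_power)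
    then have "Q0 < Q + 1" using power_less_imp_less_base by blast
    then have QQ0: "Q0 \<le> Q" by simp
    have "real n0 \<le> ?f (real t ^ c)" using ub[OF n0(1)] phi_ge_1[of y z "real t"] by linarith
    also have "\<dots> \<le> ?f (real t ^ (c + 1))"
      by (rule R1(2)) (use tR tc1 t2c in linarith)+
    also have "\<dots> \<le> ?f (real t) ^ E" by (rule t(1))
    also have "\<dots> \<le> (real (G + 1)) ^ E"
      using G(2) phi_ge_1[of y z "real t"] by (intro power_mono) auto
    also have "\<dots> \<le> (real ((Q + 1) ^ 5)) ^ E" using QG by (intro power_mono) linarith+
    also have "\<dots> = real ((Q + 1) ^ (5 * E))" by (simp add: power_mult)
    finally have n0Q: "n0 \<le> (Q + 1) ^ (5 * E)" by (simp only: of_nat_le_iff)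
    show "\<exists>Q\<ge>Q0. \<exists>n0\<in>fps_support (count_fps ?v ^ Suc k). n0 \<le> (Q + 1) ^ (5 * E) \<and>
      {n0..n0 + Q ^ 5} \<inter> fps_support (count_fps ?v ^ k * count_fps ?w ^ J) = {}"
    proof (rule exI[of _ Q], rule conjI[OF QQ0], rule bexI[of _ n0], rule conjI[OF n0Q])
      have "{n0..n0 + Q ^ 5} \<subseteq> {n0..n0 + G}" using Q5 by auto
      then show "{n0..n0 + Q ^ 5} \<inter> fps_support (count_fps ?v ^ k * count_fps ?w ^ J) = {}"
        using n0(2) unfolding B_def by blast
      show "n0 \<in> fps_support (count_fps ?v ^ Suc k)" using n0(1) Es(1) by blast
    qed
  qed
qed

section \<open>Normal form of an algebraic relation\<close>

lemma poly_eq_sum_atMost: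
  fixes p :: "'a::comm_semiring_1 poly"
  assumes "degree p \<le> n"
  shows "poly p x = (\<Sum>i\<le>n. coeff p i * x ^ i)"
  unfolding poly_altdef by (rule sum.mono_neutral_left) (use assms in \<open>auto simp: coeff_eq_0\<close>)

lemma finite_common_denominator:
  fixes A :: "rat set"
  assumes "finite A"
  shows "\<exists>D::int. D > 0 \<and> (\<forall>q\<in>A. \<exists>n. of_int D * q = of_int n)"
  using assms
proof (induction A)
  case empty
  show ?case by (intro exI[of _ 1]) simp
next
  case (insert q A)
  then obtain D where D: "D > 0" "\<And>q. q \<in> A \<Longrightarrow> \<exists>n. of_int D * q = of_int n" by blast
  obtain a b where ab: "quotient_of q = (a, b)" by fastforce
  have b: "b > 0" "q = of_int a / of_int b" using ab quotient_of_denom_pos quotient_of_div by auto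
  have "\<exists>n. of_int (D * b) * r = of_int n" if r: "r \<in> insert q A" for r
  proof (cases "r = q")
    case True
    then show ?thesis using b by (intro exI[of _ "D * a"]) simp
  next
    case False
    then obtain n where "of_int D * r = of_int n" using r D(2) by blast
    then show ?thesis by (intro exI[of _ "b * n"]) (simp add: mult.assoc mult.left_commute)
  qed
  then show ?case using D(1) b(1) by (intro exI[of _ "D * b"]) simp
qed

text \<open>Replacing Y by Y - 1 compensates the artificial exponent 0 in \<open>pow_seq\<close>,
  which raises the second value from \<open>b\<close> to \<open>1 + b\<close>.\<close>

lemma eval2_shift:
  fixes a b :: "'a::field_char_0"
  shows "eval2 (pcompose P [:-1, 1:]) a (1 + b) = eval2 P a b"
proof (induction P)
  case 0
  then show ?case by (simp add: eval2_def)
next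
  case (pCons q P)
  define h where "h = (\<lambda>q. poly (map_poly of_rat q) a)"
  have h: "h 0 = 0" "h (p + q) = h p + h q" "h (p - q) = h p - h q" for p q
    by (simp_all add: h_def of_rat_poly_hom.hom_add of_rat_poly_hom.hom_minus)
  have hp: "eval2 p a x = poly (map_poly h p) x" for p x by (simp add: eval2_def h_def)
  have add: "eval2 (p + r) a x = eval2 p a x + eval2 r a x" for p r x
  proof -
    have "map_poly h (p + r) = map_poly h p + map_poly h r"
      by (rule poly_eqI) (simp add: coeff_map_poly h)
    then show ?thesis by (simp add: hp)
  qed
  have minus: "eval2 (- p) a x = - eval2 p a x" for p x
    using add[of p "- p" x] by (simp add: hp eq_neg_iff_add_eq_0 add.commute)
  have cons: "eval2 (pCons c p) a x = h c + x * eval2 p a x" for c p x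
  proof -
    have "map_poly h (pCons c p) = pCons (h c) (map_poly h p)"
      by (rule poly_eqI) (simp add: coeff_map_poly h coeff_pCons split: nat.split)
    then show ?thesis by (simp add: hp)
  qed
  have eq: "pcompose (pCons q P) [:-1, 1:] = [:q:] + (pCons 0 (pcompose P [:-1, 1:]) + - pcompose P [:-1, 1:])"
    by (simp add: pcompose_pCons)
  have "eval2 [:q:] a x = h q" for x using cons[of q 0] by (simp add: hp)
  then have "eval2 (pcompose (pCons q P) [:-1, 1:]) a (1 + b) =
    h q + ((1 + b) * eval2 P a b - eval2 P a b)"
    unfolding eq by (simp only: add minus cons h pCons.IH) simp
  then show ?case by (simp add: cons algebra_simps)
qed

lemma eval2_eq_double_sum:
  fixes a b :: "'a::field_char_0"
  assumes "\<And>j. degree (coeff P j) \<le> k" "degree P \<le> J"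
  shows "eval2 P a b = (\<Sum>i\<le>k. \<Sum>j\<le>J. of_rat (coeff (coeff P j) i) * (a ^ i * b ^ j))"
proof -
  define h where "h = (\<lambda>q. poly (map_poly of_rat q) a)"
  have "eval2 P a b = (\<Sum>j\<le>J. coeff (map_poly h P) j * b ^ j)"
    unfolding eval2_def h_def by (rule poly_eq_sum_atMost) (use degree_map_poly_le assms(2) order.trans in blast)
  also have "\<dots> = (\<Sum>j\<le>J. h (coeff P j) * b ^ j)" by (simp add: coeff_map_poly h_def)
  also have "\<dots> = (\<Sum>j\<le>J. \<Sum>i\<le>k. of_rat (coeff (coeff P j) i) * (a ^ i * b ^ j))"
  proof (rule sum.cong)
    fix j
    have "h (coeff P j) = (\<Sum>i\<le>k. coeff (map_poly of_rat (coeff P j)) i * a ^ i)"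
      unfolding h_def by (rule poly_eq_sum_atMost) (use degree_map_poly_le assms(1) order.trans in blast)
    then show "h (coeff P j) * b ^ j = (\<Sum>i\<le>k. of_rat (coeff (coeff P j) i) * (a ^ i * b ^ j))"
      by (simp add: coeff_map_poly sum_distrib_right mult.assoc)
  qed simp
  also have "\<dots> = (\<Sum>i\<le>k. \<Sum>j\<le>J. of_rat (coeff (coeff P j) i) * (a ^ i * b ^ j))" by (rule sum.swap)
  finally show ?thesis .
qed

text \<open>The polynomial is stored by powers of Y, but its leading monomial is taken first in X:
  \<open>k\<close> is the largest degree among the coefficients, and \<open>l\<close> the last
  position at which the coefficient of X^k is nonzero.\<close>

lemma algebraic_relation_normal_form:
  fixes a b :: real
  assumes "\<not> algebraically_independent a b"
  shows "\<exists>(c :: nat \<Rightarrow> nat \<Rightarrow> int) k l J. c (Suc k) (Suc l) \<noteq> 0 \<and> (\<forall>j>Suc l. c (Suc k) j = 0) \<and> Suc l \<le> J \<and>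
    (\<Sum>i\<le>Suc k. \<Sum>j\<le>J. of_int (c i j) * (a ^ i * (1 + b) ^ j)) = 0"
proof -
  obtain P where P: "P \<noteq> 0" "eval2 P a b = 0"
    using assms unfolding algebraically_independent_def by auto
  define W where "W = pcompose P [:-1, 1:]"
  have W0: "W \<noteq> 0" using P(1) unfolding W_def by (simp add: pcompose_eq_0_iff)
  have We: "eval2 W a (1 + b) = 0" using P(2) unfolding W_def by (simp only: eval2_shift)
  define J where "J = degree W"
  define k where "k = Max ((\<lambda>j. degree (coeff W j)) ` {..J})"
  have fin: "finite ((\<lambda>j. degree (coeff W j)) ` {..J})" by simp
  have dk: "degree (coeff W j) \<le> k" for j
  proof (cases "j \<le> J")
    case True
    then show ?thesis unfolding k_def by (intro Max_ge fin) auto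
  next
    case False
    then show ?thesis by (simp add: J_def coeff_eq_0)
  qed
  have "\<exists>j. coeff (coeff W j) k \<noteq> 0"
  proof -
    have "k \<in> (\<lambda>j. degree (coeff W j)) ` {..J}" unfolding k_def by (intro Max_in fin) auto
    then obtain j where j: "k = degree (coeff W j)" by auto
    show ?thesis
    \<comment> \<open>The zero polynomial has degree 0 by convention, so it can attain the maximum
      only for \<open>k = 0\<close>; the leading coefficient of \<open>W\<close> is then a nonzero
      constant and serves instead.\<close>
    proof (cases "coeff W j = 0")
      case True
      then have "k = 0" using j by simp
      have "coeff W J \<noteq> 0" using W0 by (simp add: J_def)
      moreover have "degree (coeff W J) = 0" using dk[of J] \<open>k = 0\<close> by simp
      ultimately have "coeff (coeff W J) k \<noteq> 0" using \<open>k = 0\<close> leading_coeff_0_iff[of "coeff W J"] by simp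
      then show ?thesis by blast
    next
      case False
      then show ?thesis unfolding j by (intro exI[of _ j]) simp
    qed
  qed
  then obtain j0 where j0: "coeff (coeff W j0) k \<noteq> 0" by blast
  define M where "M = {j. coeff (coeff W j) k \<noteq> 0}"
  have Msub: "M \<subseteq> {..J}" unfolding M_def J_def by (auto intro: ccontr simp: coeff_eq_0)
  then have Mfin: "finite M" by (rule finite_subset) simp
  define l where "l = Max M"
  have l: "l \<in> M" unfolding l_def using Mfin j0 by (intro Max_in) (auto simp: M_def)
  have lmax: "coeff (coeff W j) k = 0" if "j > l" for j
    using Max_ge[OF Mfin, of j] that unfolding l_def M_def by (metis mem_Collect_eq not_le)
  define Cs where "Cs = (\<lambda>(i, j). coeff (coeff W j) i) ` ({..k} \<times> {..J})"
  have "finite Cs" by (simp add: Cs_def)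
  then obtain D :: int where D: "D > 0" "\<And>q. q \<in> Cs \<Longrightarrow> \<exists>n. of_int D * q = of_int n"
    using finite_common_denominator by metis
  have "\<exists>n. of_int D * coeff (coeff W j) i = of_int n" for i j
  proof (cases "i \<le> k \<and> j \<le> J")
    case True
    then show ?thesis by (intro D(2)) (auto simp: Cs_def)
  next
    case False
    then have "coeff (coeff W j) i = 0" using dk[of j] by (auto simp: J_def coeff_eq_0)
    then show ?thesis by (intro exI[of _ 0]) simp
  qed
  then have "\<forall>i j. \<exists>n. of_int D * coeff (coeff W j) i = of_int n" by blast
  then obtain n :: "nat \<Rightarrow> nat \<Rightarrow> int" where n: "\<And>i j. of_int D * coeff (coeff W j) i = of_int (n i j)"
    by metis
  have n0: "n i j = 0 \<longleftrightarrow> coeff (coeff W j) i = 0" for i j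
  proof -
    have "n i j = 0 \<longleftrightarrow> of_int (n i j) = (0::rat)" by simp
    also have "\<dots> \<longleftrightarrow> coeff (coeff W j) i = 0" unfolding n[symmetric] using D(1) by simp
    finally show ?thesis .
  qed
  have nr: "real_of_int (n i j) = of_int D * of_rat (coeff (coeff W j) i)" for i j
    by (metis n of_rat_mult of_rat_of_int_eq)
  \<comment> \<open>Multiplying the relation by \<open>X * Y\<close> makes both leading exponents positive.\<close>
  define c where "c = (\<lambda>i j. if i = 0 \<or> j = 0 then 0 else n (i - 1) (j - 1))"
  have "(\<Sum>i\<le>Suc k. \<Sum>j\<le>Suc J. of_int (c i j) * (a ^ i * (1 + b) ^ j)) =
    (\<Sum>i\<le>k. \<Sum>j\<le>J. of_int (n i j) * (a ^ Suc i * (1 + b) ^ Suc j))"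
    by (simp only: sum.atMost_Suc_shift) (simp add: c_def)
  also have "\<dots> = of_int D * a * (1 + b) * (\<Sum>i\<le>k. \<Sum>j\<le>J. of_rat (coeff (coeff W j) i) * (a ^ i * (1 + b) ^ j))"
    unfolding sum_distrib_left nr by (intro sum.cong refl) simp
  also have "\<dots> = 0"
    using We eval2_eq_double_sum[of W k J a "1 + b", OF dk] by (simp add: J_def)
  finally have "(\<Sum>i\<le>Suc k. \<Sum>j\<le>Suc J. of_int (c i j) * (a ^ i * (1 + b) ^ j)) = 0" .
  moreover have "c (Suc k) (Suc l) \<noteq> 0" using l by (simp add: c_def n0 M_def)
  moreover have "\<forall>j>Suc l. c (Suc k) j = 0"
  proof (intro allI impI)
    fix j assume "j > Suc l"
    then have "j - 1 > l" "j \<noteq> 0" by auto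
    then show "c (Suc k) j = 0" using lmax by (simp add: c_def n0)
  qed
  moreover have "Suc l \<le> Suc J" using l Msub by auto
  ultimately show ?thesis by blast
qed

section \<open>Values of the two series and the final contradiction\<close>

lemma fps_value_count_fps_superpolynomial:
  fixes z :: real
  assumes v: "superpolynomial v" "v 0 = 0" and z: "0 \<le> z" "z < 1"
  shows "fps_value z (count_fps v) = 1 + (\<Sum>m. z ^ v (Suc m))" "polynomially_bounded (count_fps v)"
proof -
  obtain m0 where m0: "\<And>m. m \<ge> m0 \<Longrightarrow> m \<le> v m"
    using v(1) unfolding superpolynomial_def by (metis power_one_right)
  show "polynomially_bounded (count_fps v)" by (rule polynomially_bounded_count_fps[OF m0])
  have "(\<Sum>m. z ^ v (Suc m)) = (\<Sum>m. z ^ v m) - z ^ v 0"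
    by (rule suminf_split_head[OF summable_power_of_superlinear[OF m0 z]])
  then show "fps_value z (count_fps v) = 1 + (\<Sum>m. z ^ v (Suc m))"
    using fps_value_count_fps[OF m0 z] v(2) by simp
qed

theorem theorem3p5:
  fixes x y z \<beta> :: real
  assumes "(y, z) \<in> Theta"
    and "x > 1"
    and "pisot_number \<beta> \<or> salem_number \<beta>"
  shows "algebraically_independent (xi y z (inverse \<beta>)) (\<Sum>m::nat. \<beta> powi (- \<lfloor>x ^ m\<rfloor>))"
proof (rule ccontr)
  let ?S = "count_fps (phi_seq y z)" and ?T = "count_fps (pow_seq x)"
  let ?\<xi> = "xi y z (inverse \<beta>)" and ?\<eta> = "\<Sum>m::nat. \<beta> powi (- \<lfloor>x ^ m\<rfloor>)"
  have \<beta>: "algebraic_int \<beta>" "\<beta> > 1" "\<forall>w \<in> conjugates \<beta> - {complex_of_real \<beta>}. cmod w \<le> 1"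
    using assms(3) unfolding pisot_number_def salem_number_def by (auto intro: less_imp_le)
  have b01: "0 \<le> 1 / \<beta>" "1 / \<beta> < 1" "\<bar>1 / \<beta>\<bar> < 1" using \<beta>(2) by auto
  have v: "superpolynomial (phi_seq y z)" "phi_seq y z 0 = 0"
    using superpolynomial_phi_seq[OF assms(1)] by (auto simp: phi_seq_def)
  have w: "superpolynomial (pow_seq x)" "pow_seq x 0 = 0"
    using superpolynomial_pow_seq[OF assms(2)] by (auto simp: pow_seq_def)
  have S: "polynomially_bounded ?S" "fps_value (1 / \<beta>) ?S = ?\<xi>"
  proof -
    show "polynomially_bounded ?S" by (rule fps_value_count_fps_superpolynomial(2)[OF v b01(1,2)])
    have "(1 / \<beta>) ^ phi_seq y z (Suc m) = inverse \<beta> powi \<lfloor>phi y z (real (m + 3))\<rfloor>" for m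
      using phi_ge_1[of y z "real (m + 3)"] by (simp add: phi_seq_def power_int_def inverse_eq_divide)
    then show "fps_value (1 / \<beta>) ?S = ?\<xi>"
      using fps_value_count_fps_superpolynomial(1)[OF v b01(1,2)] by (simp add: xi_def)
  qed
  have T: "polynomially_bounded ?T" "fps_value (1 / \<beta>) ?T = 1 + ?\<eta>"
  proof -
    show "polynomially_bounded ?T" by (rule fps_value_count_fps_superpolynomial(2)[OF w b01(1,2)])
    have "(1 / \<beta>) ^ pow_seq x (Suc m) = \<beta> powi (- \<lfloor>x ^ m\<rfloor>)" for m
    proof -
      have "0 \<le> \<lfloor>x ^ m\<rfloor>" using assms(2) by simp
      then show ?thesis by (simp add: pow_seq_def power_int_minus power_int_def power_divide field_simps)
    qed
    then show "fps_value (1 / \<beta>) ?T = 1 + ?\<eta>"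
      using fps_value_count_fps_superpolynomial(1)[OF w b01(1,2)] by simp
  qed
  assume "\<not> algebraically_independent ?\<xi> ?\<eta>"
  from algebraic_relation_normal_form[OF this]
  obtain c :: "nat \<Rightarrow> nat \<Rightarrow> int" and k l J :: nat where c: "c (Suc k) (Suc l) \<noteq> 0" "\<And>j. j > Suc l \<Longrightarrow> c (Suc k) j = 0"
    "Suc l \<le> J" "(\<Sum>i\<le>Suc k. \<Sum>j\<le>J. of_int (c i j) * (?\<xi> ^ i * (1 + ?\<eta>) ^ j)) = 0"
    by blast
  obtain d :: nat where d: "\<And>p::int poly. poly (map_poly of_int p) \<beta> \<noteq> 0 \<Longrightarrow>
      1 \<le> \<bar>poly (map_poly of_int p) \<beta>\<bar> * of_int (poly_length p) ^ d"
    using small_conjugates_lower_bound[OF \<beta>(1,3)] by blast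
  have pb: "polynomially_bounded (?S ^ i * ?T ^ j)" for i j
    by (intro polynomially_bounded_mult polynomially_bounded_power S(1) T(1))
  have pb': "polynomially_bounded (of_int n * (?S ^ i * ?T ^ j))" for n i j
    by (intro polynomially_bounded_mult polynomially_bounded_of_int pb)
  have "fps_value (1 / \<beta>) (\<Sum>i\<le>Suc k. \<Sum>j\<le>J. of_int (c i j) * (?S ^ i * ?T ^ j)) =
    (\<Sum>i\<le>Suc k. \<Sum>j\<le>J. fps_value (1 / \<beta>) (of_int (c i j) * (?S ^ i * ?T ^ j)))"
    using pb' b01(3) by (simp only: fps_value_sum polynomially_bounded_sum)
  also have "\<dots> = (\<Sum>i\<le>Suc k. \<Sum>j\<le>J. of_int (c i j) * (?\<xi> ^ i * (1 + ?\<eta>) ^ j))"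
  proof (intro sum.cong refl)
    fix i j
    have "fps_value (1 / \<beta>) (?S ^ i * ?T ^ j) = ?\<xi> ^ i * (1 + ?\<eta>) ^ j"
      using S T b01(3) by (simp only: fps_value_mult fps_value_power polynomially_bounded_power)
    then show "fps_value (1 / \<beta>) (of_int (c i j) * (?S ^ i * ?T ^ j)) = of_int (c i j) * (?\<xi> ^ i * (1 + ?\<eta>) ^ j)"
      using fps_value_mult[OF polynomially_bounded_of_int pb b01(3)] by (simp only: fps_value_of_int)
  qed
  also have "\<dots> = 0" by (rule c(4))
  finally show False
    using no_leading_relation[of \<beta> d "phi_seq y z" "pow_seq x" c k l J, OF \<beta>(2) d v w boundedly_spaced_pow_seq[OF assms(2)]
        separated_phi_pow[OF assms(1,2)] c(1,2,3)] by blast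
qed

end
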